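(* There exists a positive constant $C$ such that $\|S_f\|\leq C$ for all univalent harmonic mappings $f$ in the unit disk $\mathbb{D}$.
   Context: $\mathbb{D}=\{z\in\mathbb{C}:|z|<1\}$. A harmonic mapping is a complex-valued harmonic function; in $\mathbb{D}$ it is written $f=h+\overline{g}$ with $h,g$ analytic. Univalent means injective. A univalent (more generally, locally univalent) harmonic mapping has non-vanishing Jacobian $J_f=|h'|^2-|g'|^2$; it is sense-preserving if $J_f>0$ and sense-reversing if $J_f<0$ (then $\overline{f}$ is sense-preserving). For sense-preserving $f$, $h'\neq0$ and the dilatation $\omega=g'/h'$ is analytic with $|\omega|<1$; its Schwarzian derivative is $$S_f=Sh+\frac{\overline{\omega}}{1-|\omega|^2}\left(\frac{h''}{h'}\,\omega'-\omega''\right)-\frac32\left(\frac{\omega'\,\overline{\omega}}{1-|\omega|^2}\right)^2,$$ where $Sh=(h''/h')'-\frac12(h''/h')^2$ is the classical Schwarzian derivative. For sense-reversing $f$, $S_f:=S_{\overline{f}}$. The Schwarzian norm is $\|S_f\|=\sup_{z\in\mathbb{D}}|S_f(z)|(1-|z|^2)^2$. *)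

theory Defs
  imports "HOL-Complex_Analysis.Complex_Analysis"
begin

abbreviation unit_disk :: "complex set" where
  "unit_disk \<equiv> ball 0 1"

(* Twice continuously (real) differentiable with vanishing Laplacian.  Here f' z and f'' z are the
   first and second real Frechet derivatives, so that f'' z 1 1 and f'' z i i are the second partial
   derivatives f_xx and f_yy.  Intended for open S. *)
definition harmonic_on :: "complex set \<Rightarrow> (complex \<Rightarrow> complex) \<Rightarrow> bool" where
  "harmonic_on S f \<longleftrightarrow>
     (\<exists>(f' :: complex \<Rightarrow> complex \<Rightarrow>\<^sub>L complex) (f'' :: complex \<Rightarrow> complex \<Rightarrow>\<^sub>L complex \<Rightarrow>\<^sub>L complex).
        (\<forall>z\<in>S. (f has_derivative blinfun_apply (f' z)) (at z) \<and>
               (f' has_derivative blinfun_apply (f'' z)) (at z)) \<and>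
        continuous_on S f'' \<and>
        (\<forall>z\<in>S. blinfun_apply (blinfun_apply (f'' z) 1) 1 +
               blinfun_apply (blinfun_apply (f'' z) \<i>) \<i> = 0))"

definition harmonic_decomposition ::
    "(complex \<Rightarrow> complex) \<Rightarrow> (complex \<Rightarrow> complex) \<Rightarrow> (complex \<Rightarrow> complex) \<Rightarrow> bool" where
  "harmonic_decomposition f h g \<longleftrightarrow>
     h holomorphic_on unit_disk \<and> g holomorphic_on unit_disk \<and>
     (\<forall>z\<in>unit_disk. f z = h z + cnj (g z))"

(* On the disk, h and g are unique up to additive constants.  Everything below uses only their
   derivatives at points of the disk, so it does not depend on the choice made here. *)
definition analytic_part :: "(complex \<Rightarrow> complex) \<Rightarrow> complex \<Rightarrow> complex" where
  "analytic_part f = (SOME h. \<exists>g. harmonic_decomposition f h g)"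

definition coanalytic_part :: "(complex \<Rightarrow> complex) \<Rightarrow> complex \<Rightarrow> complex" where
  "coanalytic_part f = (SOME g. harmonic_decomposition f (analytic_part f) g)"

definition harmonic_jacobian :: "(complex \<Rightarrow> complex) \<Rightarrow> complex \<Rightarrow> real" where
  "harmonic_jacobian f z =
     (cmod (deriv (analytic_part f) z))\<^sup>2 - (cmod (deriv (coanalytic_part f) z))\<^sup>2"

definition sense_preserving :: "(complex \<Rightarrow> complex) \<Rightarrow> bool" where
  "sense_preserving f \<longleftrightarrow> (\<forall>z\<in>unit_disk. harmonic_jacobian f z > 0)"

definition sense_reversing :: "(complex \<Rightarrow> complex) \<Rightarrow> bool" where
  "sense_reversing f \<longleftrightarrow> (\<forall>z\<in>unit_disk. harmonic_jacobian f z < 0)"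

definition dilatation :: "(complex \<Rightarrow> complex) \<Rightarrow> complex \<Rightarrow> complex" where
  "dilatation f z = deriv (coanalytic_part f) z / deriv (analytic_part f) z"

definition pre_schwarzian :: "(complex \<Rightarrow> complex) \<Rightarrow> complex \<Rightarrow> complex" where
  "pre_schwarzian h z = deriv (deriv h) z / deriv h z"

definition classical_schwarzian :: "(complex \<Rightarrow> complex) \<Rightarrow> complex \<Rightarrow> complex" where
  "classical_schwarzian h z = deriv (pre_schwarzian h) z - (pre_schwarzian h z)\<^sup>2 / 2"

definition sense_preserving_schwarzian :: "(complex \<Rightarrow> complex) \<Rightarrow> complex \<Rightarrow> complex" where
  "sense_preserving_schwarzian f z =
     (let h = analytic_part f; \<omega> = dilatation f; d = complex_of_real (1 - (cmod (\<omega> z))\<^sup>2) in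
      classical_schwarzian h z
      + cnj (\<omega> z) / d * (deriv (deriv h) z / deriv h z * deriv \<omega> z - deriv (deriv \<omega>) z)
      - 3 / 2 * (deriv \<omega> z * cnj (\<omega> z) / d)\<^sup>2)"

(* Unspecified for mappings whose Jacobian vanishes somewhere in the disk or changes sign. *)
definition harmonic_schwarzian :: "(complex \<Rightarrow> complex) \<Rightarrow> complex \<Rightarrow> complex" where
  "harmonic_schwarzian f =
     (if sense_preserving f then sense_preserving_schwarzian f
      else if sense_reversing f then sense_preserving_schwarzian (\<lambda>z. cnj (f z))
      else undefined)"

(* Taken in the extended reals, so that an unbounded set of values gives infinity. *)
definition schwarzian_norm :: "(complex \<Rightarrow> complex) \<Rightarrow> ereal" where
  "schwarzian_norm f =
     (SUP z\<in>unit_disk. ereal (cmod (harmonic_schwarzian f z) * (1 - (cmod z)\<^sup>2)\<^sup>2))"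

end

theory Submission
  imports Defs
begin

text \<open>
  Write $f = h + \bar g$ on the disk, $\<omega> = g'/h'$, and $P_f = \<partial>/\<partial>z \log J_f$. The quantity $P_f$ is unchanged
  when $f$ is followed by an invertible affine map of the plane. The theorem follows from the estimate
  $|P_f(z)|\,(1-|z|) \<le> 2R$ with an absolute constant $R$, valid for all univalent sense-preserving harmonic $f$
  (\<open>univalent_jacobian_slope_bound\<close>).

  This estimate is proved by blowing up. If it failed, rescaling at a point where $|P_f|$ is large relative to
  the distance to a smaller circle would give a univalent harmonic mapping on the disk of radius $R$ with
  $|P| \<le> 2$ there and $|P(0)| = 1$. After an affine normalization the dilatation vanishes at $0$, and Schwarz's lemma makes it
  small on compact sets: the mapping is almost holomorphic. Moreover $h''/h'$ is bounded on a disk of radius comparable to $R$, so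
  it is almost constant on a fixed disk, just as in Liouville's theorem. Thus the mapping is
  close to $(\exp(cz)-1)/c$ with $|c|=1$. That function is periodic, and a fixed point argument shows that
  a nearby continuous function also repeats a value
  (\<open>perturbed_exponential_not_injective\<close>), which contradicts univalence.

  The Schwarzian derivative $S_f(z_0)$ equals the classical Schwarzian of the holomorphic part of that affine
  image of $f$ whose dilatation vanishes at $z_0$ (\<open>shear_schwarzian\<close>). For this holomorphic part $h''/h'$
  is controlled by $P_f$ near $z_0$, and Cauchy's inequality bounds its derivative
  (\<open>schwarzian_bound_from_slope_bound\<close>).

  Two classical facts connect this with arbitrary univalent harmonic mappings: the decomposition
  $f = h + \bar g$ (\<open>harmonic_on_decomposition\<close>), and Lewy's theorem that the Jacobian of a univalent
  harmonic mapping has no zeros (\<open>lewy_univalent_harmonic\<close>), so that $f$ or $\bar f$ is sense-preserving.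
\<close>

section \<open>Harmonic functions on the disk are sums of a holomorphic and an antiholomorphic function\<close>

text \<open>
  Along the segment from $z$ in direction $u$, the increment of $x \<mapsto> f(x + sv) - f(x)$ has a derivative
  that differs from $s B(v,u)$ by $o(s)$, because $f'$ is differentiable at $z$. The mean value inequality
  turns this into an estimate for the second difference, an expression that does not change when $u$ and $v$
  are exchanged.
\<close>

lemma second_difference_estimate:
  fixes f :: "'a::real_normed_vector \<Rightarrow> 'b::real_normed_vector"
    and f' :: "'a \<Rightarrow> 'a \<Rightarrow>\<^sub>L 'b" and B :: "'a \<Rightarrow>\<^sub>L 'a \<Rightarrow>\<^sub>L 'b"
  assumes S: "open S" "z \<in> S"
    and f: "\<And>x. x \<in> S \<Longrightarrow> (f has_derivative blinfun_apply (f' x)) (at x)"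
    and B: "(f' has_derivative blinfun_apply B) (at z)"
    and e: "e > 0"
  shows "\<exists>d>0. \<forall>s. 0 < s \<and> s < d \<longrightarrow>
    norm (f (z + s *\<^sub>R u + s *\<^sub>R v) - f (z + s *\<^sub>R u) - f (z + s *\<^sub>R v) + f z - s\<^sup>2 *\<^sub>R B v u) \<le> e * s\<^sup>2"
proof -
  define M where "M = norm u + norm v + 1"
  have M: "M > 0" "norm u \<le> M" "norm v \<le> M"
    by (auto simp: M_def add_nonneg_pos)
  define e' where "e' = e / (2 * M\<^sup>2)"
  have e': "e' > 0" using e M by (simp add: e'_def)
  obtain d0 where d0: "d0 > 0"
    "\<And>y. norm (y - z) < d0 \<Longrightarrow> norm (f' y - f' z - B (y - z)) \<le> e' * norm (y - z)"
    using B e' unfolding has_derivative_at_alt by blast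
  obtain r where r: "r > 0" "ball z r \<subseteq> S"
    using S open_contains_ball by blast
  define d where "d = min d0 r / M"
  have "d > 0" using d0 r M by (simp add: d_def)
  moreover have "norm (f (z + s *\<^sub>R u + s *\<^sub>R v) - f (z + s *\<^sub>R u) - f (z + s *\<^sub>R v) + f z - s\<^sup>2 *\<^sub>R B v u) \<le> e * s\<^sup>2"
    if s: "0 < s" "s < d" for s
  proof -
    have sM: "s * M < min d0 r"
      using s M by (simp add: d_def pos_less_divide_eq)
    define \<phi> where "\<phi> t = f (z + t *\<^sub>R u + s *\<^sub>R v) - f (z + t *\<^sub>R u) - (t * s) *\<^sub>R B v u" for t
    define \<phi>' where "\<phi>' t = blinfun_apply (f' (z + t *\<^sub>R u + s *\<^sub>R v) - f' (z + t *\<^sub>R u) - s *\<^sub>R B v) u" for t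
    have near1: "norm (z + t *\<^sub>R u + s *\<^sub>R v - z) \<le> s * M" "norm (z + t *\<^sub>R u - z) \<le> s * M"
      if t: "t \<in> {0..s}" for t
    proof -
      have a: "norm (t *\<^sub>R u) \<le> s * norm u" using t by (simp add: mult_right_mono)
      have b: "norm (s *\<^sub>R v) = s * norm v" using s by simp
      have "norm (t *\<^sub>R u + s *\<^sub>R v) \<le> s * norm u + s * norm v"
        using norm_triangle_ineq[of "t *\<^sub>R u" "s *\<^sub>R v"] a b by linarith
      also have "\<dots> \<le> s * M" using s by (simp add: M_def distrib_left[symmetric] del: distrib_left)
      finally show "norm (z + t *\<^sub>R u + s *\<^sub>R v - z) \<le> s * M" by (simp add: add.assoc)
      have "s * norm u \<le> s * M" using M s by simp
      with a show "norm (z + t *\<^sub>R u - z) \<le> s * M" by simp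
    qed
    have inS: "z + t *\<^sub>R u + s *\<^sub>R v \<in> S" "z + t *\<^sub>R u \<in> S" if t: "t \<in> {0..s}" for t
    proof -
      have "dist z (z + t *\<^sub>R u + s *\<^sub>R v) < r" "dist z (z + t *\<^sub>R u) < r"
        using near1[OF t] sM by (auto simp only: dist_norm norm_minus_commute[of z] min_less_iff_conj)
      then show "z + t *\<^sub>R u + s *\<^sub>R v \<in> S" "z + t *\<^sub>R u \<in> S" using r by auto
    qed
    have der: "(\<phi> has_derivative (\<lambda>h. h *\<^sub>R \<phi>' t)) (at t within {0..s})" if t: "t \<in> {0..s}" for t
    proof -
      have 1: "((\<lambda>t. f (z + t *\<^sub>R u + s *\<^sub>R v)) has_derivative (\<lambda>h. f' (z + t *\<^sub>R u + s *\<^sub>R v) (h *\<^sub>R u))) (at t within {0..s})"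
        by (rule has_derivative_compose[where g = f and x = t and f = "\<lambda>t. z + t *\<^sub>R u + s *\<^sub>R v", OF _ f[OF inS(1)[OF t]]]) (auto intro!: derivative_eq_intros)
      have 2: "((\<lambda>t. f (z + t *\<^sub>R u)) has_derivative (\<lambda>h. f' (z + t *\<^sub>R u) (h *\<^sub>R u))) (at t within {0..s})"
        by (rule has_derivative_compose[where g = f and x = t and f = "\<lambda>t. z + t *\<^sub>R u", OF _ f[OF inS(2)[OF t]]]) (auto intro!: derivative_eq_intros)
      show ?thesis unfolding \<phi>_def
        by (rule derivative_eq_intros 1 2 refl)+
          (auto simp: \<phi>'_def blinfun.bilinear_simps scaleR_diff_right fun_eq_iff)
    qed
    have bd: "onorm (\<lambda>h. h *\<^sub>R \<phi>' t) \<le> e * s" if t: "t \<in> {0..s}" for t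
    proof -
      let ?a = "z + t *\<^sub>R u + s *\<^sub>R v" and ?b = "z + t *\<^sub>R u"
      have a: "norm (f' ?a - f' z - B (?a - z)) \<le> e' * (s * M)"
        using d0(2)[of ?a] near1(1)[OF t] sM e'
        by (meson min_less_iff_conj mult_left_mono order_le_less_trans order_trans less_imp_le)
      have b: "norm (f' ?b - f' z - B (?b - z)) \<le> e' * (s * M)"
        using d0(2)[of ?b] near1(2)[OF t] sM e'
        by (meson min_less_iff_conj mult_left_mono order_le_less_trans order_trans less_imp_le)
      have "f' ?a - f' ?b - s *\<^sub>R B v = (f' ?a - f' z - B (?a - z)) - (f' ?b - f' z - B (?b - z))"
        by (simp add: blinfun.bilinear_simps algebra_simps)
      then have "norm (f' ?a - f' ?b - s *\<^sub>R B v) \<le> 2 * (e' * (s * M))"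
        using a b by (smt (verit) norm_triangle_ineq4)
      then have "norm (\<phi>' t) \<le> 2 * (e' * (s * M)) * M"
        unfolding \<phi>'_def using M e' s
        by (intro order_trans[OF norm_blinfun] mult_mono) auto
      also have "\<dots> = e * s" using M by (simp add: e'_def power2_eq_square)
      finally show ?thesis
        by (intro onorm_le) (simp add: mult.commute mult_left_mono)
    qed
    have "norm (\<phi> s - \<phi> 0) \<le> e * s * norm (s - 0)"
      by (rule differentiable_bound[OF _ der bd]) (use s in auto)
    moreover have "\<phi> s - \<phi> 0 = f (z + s *\<^sub>R u + s *\<^sub>R v) - f (z + s *\<^sub>R u) - f (z + s *\<^sub>R v) + f z - s\<^sup>2 *\<^sub>R B v u"
      by (simp add: \<phi>_def power2_eq_square)
    ultimately show ?thesis using s by (simp add: power2_eq_square mult.assoc)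
  qed
  ultimately show ?thesis by blast
qed

lemma second_derivative_symmetric:
  fixes f :: "'a::real_normed_vector \<Rightarrow> 'b::real_normed_vector"
    and f' :: "'a \<Rightarrow> 'a \<Rightarrow>\<^sub>L 'b" and B :: "'a \<Rightarrow>\<^sub>L 'a \<Rightarrow>\<^sub>L 'b"
  assumes S: "open S" "z \<in> S"
    and f: "\<And>x. x \<in> S \<Longrightarrow> (f has_derivative blinfun_apply (f' x)) (at x)"
    and B: "(f' has_derivative blinfun_apply B) (at z)"
  shows "B u v = B v u"
proof -
  have "norm (B u v - B v u) \<le> e" if "e > 0" for e
  proof -
    have e2: "e / 2 > 0" using that by simp
    obtain d1 where d1: "d1 > 0" "\<And>s. 0 < s \<and> s < d1 \<Longrightarrow>
      norm (f (z + s *\<^sub>R u + s *\<^sub>R v) - f (z + s *\<^sub>R u) - f (z + s *\<^sub>R v) + f z - s\<^sup>2 *\<^sub>R B v u) \<le> e/2 * s\<^sup>2"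
      using second_difference_estimate[OF S f B e2, of u v] by blast
    obtain d2 where d2: "d2 > 0" "\<And>s. 0 < s \<and> s < d2 \<Longrightarrow>
      norm (f (z + s *\<^sub>R v + s *\<^sub>R u) - f (z + s *\<^sub>R v) - f (z + s *\<^sub>R u) + f z - s\<^sup>2 *\<^sub>R B u v) \<le> e/2 * s\<^sup>2"
      using second_difference_estimate[OF S f B e2, of v u] by blast
    define s where "s = min d1 d2 / 2"
    have s: "s > 0" "s < d1" "s < d2" using d1(1) d2(1) by (auto simp: s_def min_def)
    define D where "D = f (z + s *\<^sub>R u + s *\<^sub>R v) - f (z + s *\<^sub>R u) - f (z + s *\<^sub>R v) + f z"
    have D2: "f (z + s *\<^sub>R v + s *\<^sub>R u) - f (z + s *\<^sub>R v) - f (z + s *\<^sub>R u) + f z = D"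
      by (simp add: D_def algebra_simps)
    have "norm (D - s\<^sup>2 *\<^sub>R B v u) \<le> e/2 * s\<^sup>2" "norm (D - s\<^sup>2 *\<^sub>R B u v) \<le> e/2 * s\<^sup>2"
      using d1(2)[of s] d2(2)[of s] s D2 by (auto simp: D_def)
    then have "norm ((D - s\<^sup>2 *\<^sub>R B v u) - (D - s\<^sup>2 *\<^sub>R B u v)) \<le> e * s\<^sup>2"
      by (smt (verit) norm_triangle_ineq4 field_sum_of_halves distrib_right)
    moreover have "(D - s\<^sup>2 *\<^sub>R B v u) - (D - s\<^sup>2 *\<^sub>R B u v) = s\<^sup>2 *\<^sub>R (B u v - B v u)"
      by (simp add: algebra_simps)
    ultimately have "s\<^sup>2 * norm (B u v - B v u) \<le> s\<^sup>2 * e" by (simp add: mult.commute)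
    then show ?thesis using s by simp
  qed
  then have "norm (B u v - B v u) \<le> 0" by (metis field_le_epsilon add_0)
  then show ?thesis by simp
qed

lemma holomorphic_from_cauchy_riemann:
  assumes "open S" "\<And>z. z \<in> S \<Longrightarrow> (p has_derivative (\<lambda>v. c z * v)) (at z)"
  shows "p holomorphic_on S"
  using assms by (auto simp: holomorphic_on_open has_field_derivative_def)

lemma complex_linear_expand:
  fixes T :: "complex \<Rightarrow>\<^sub>L 'b::real_normed_vector"
  shows "T v = Re v *\<^sub>R T 1 + Im v *\<^sub>R T \<i>"
proof -
  have "v = Re v *\<^sub>R 1 + Im v *\<^sub>R \<i>" by (simp add: complex_eq_iff)
  then have "T v = T (Re v *\<^sub>R 1 + Im v *\<^sub>R \<i>)" by simp
  then show ?thesis by (simp add: blinfun.bilinear_simps)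
qed

text \<open>
  With $a = f_x$ and $b = f_y$ these are the operators $\<partial>/\<partial>z$ and $\<partial>/\<partial>{\bar z}$.
\<close>

lemma wirtinger_derivative:
  assumes "(a has_derivative a') F" "(b has_derivative b') F"
  shows "((\<lambda>z. (a z - \<i> * b z) / 2) has_derivative (\<lambda>v. (a' v - \<i> * b' v) / 2)) F"
    and "((\<lambda>z. (a z + \<i> * b z) / 2) has_derivative (\<lambda>v. (a' v + \<i> * b' v) / 2)) F"
  using assms
  by (auto intro!: derivative_eq_intros bounded_linear.has_derivative[OF bounded_linear_divide])

text \<open>
  Laplace's equation and the symmetry of the second derivative are the Cauchy-Riemann equations for
  $p = \<partial>f/\<partial>z$ and for $q = \<partial>\bar f/\<partial>z$. The disk is convex, so $p$ and $q$ have
  primitives $h$ and $g$, and $f - h - \bar g$ has derivative zero.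
\<close>

lemma harmonic_on_decomposition:
  assumes "harmonic_on unit_disk f"
  shows "\<exists>h g. harmonic_decomposition f h g"
proof -
  let ?D = unit_disk
  obtain f' :: "complex \<Rightarrow> complex \<Rightarrow>\<^sub>L complex" and f'' :: "complex \<Rightarrow> complex \<Rightarrow>\<^sub>L complex \<Rightarrow>\<^sub>L complex" where
    d1: "\<And>z. z \<in> ?D \<Longrightarrow> (f has_derivative blinfun_apply (f' z)) (at z)" and
    d2: "\<And>z. z \<in> ?D \<Longrightarrow> (f' has_derivative blinfun_apply (f'' z)) (at z)" and
    lap: "\<And>z. z \<in> ?D \<Longrightarrow> f'' z 1 1 + f'' z \<i> \<i> = 0"
    using assms unfolding harmonic_on_def by blast
  have sym: "f'' z \<i> 1 = f'' z 1 \<i>" if "z \<in> ?D" for z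
    using second_derivative_symmetric[OF open_ball that d1 d2[OF that]] by blast
  have ii: "f'' z \<i> \<i> = - f'' z 1 1" if "z \<in> ?D" for z
    using lap[OF that] by (simp add: add_eq_0_iff)
  define p where "p z = (f' z 1 - \<i> * f' z \<i>) / 2" for z
  define q where "q z = cnj ((f' z 1 + \<i> * f' z \<i>) / 2)" for z
  have dap: "((\<lambda>z. f' z w) has_derivative (\<lambda>v. f'' z v w)) (at z)" if "z \<in> ?D" for z w
    using d2[OF that] by (auto intro!: derivative_eq_intros simp: blinfun.bilinear_simps)
  have expand: "f'' z v w = Re v *\<^sub>R f'' z 1 w + Im v *\<^sub>R f'' z \<i> w" for z v w
    by (subst complex_linear_expand) (simp add: blinfun.bilinear_simps)
  have "p holomorphic_on ?D"
  proof (rule holomorphic_from_cauchy_riemann)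
    fix z assume z: "z \<in> ?D"
    have "(p has_derivative (\<lambda>v. (f'' z v 1 - \<i> * f'' z v \<i>) / 2)) (at z)"
      unfolding p_def by (intro wirtinger_derivative(1) dap[OF z])
    also have "(\<lambda>v. (f'' z v 1 - \<i> * f'' z v \<i>) / 2) = (\<lambda>v. (f'' z 1 1 - \<i> * f'' z 1 \<i>) / 2 * v)"
    proof
      fix v show "(f'' z v 1 - \<i> * f'' z v \<i>) / 2 = (f'' z 1 1 - \<i> * f'' z 1 \<i>) / 2 * v"
      unfolding expand[of z v] sym[OF z] ii[OF z]
      by (simp add: complex_eq_iff field_simps)
    qed
    finally show "(p has_derivative (\<lambda>v. (f'' z 1 1 - \<i> * f'' z 1 \<i>) / 2 * v)) (at z)" .
  qed auto
  then obtain h where h: "\<And>z. z \<in> ?D \<Longrightarrow> (h has_field_derivative p z) (at z within ?D)"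
    using holomorphic_convex_primitive'[of ?D p] by auto
  have "q holomorphic_on ?D"
  proof (rule holomorphic_from_cauchy_riemann)
    fix z assume z: "z \<in> ?D"
    have "(q has_derivative (\<lambda>v. cnj ((f'' z v 1 + \<i> * f'' z v \<i>) / 2))) (at z)"
      unfolding q_def
      by (intro has_derivative_cnj wirtinger_derivative(2) dap[OF z])
    also have "(\<lambda>v. cnj ((f'' z v 1 + \<i> * f'' z v \<i>) / 2)) = (\<lambda>v. cnj ((f'' z 1 1 + \<i> * f'' z 1 \<i>) / 2) * v)"
    proof
      fix v show "cnj ((f'' z v 1 + \<i> * f'' z v \<i>) / 2) = cnj ((f'' z 1 1 + \<i> * f'' z 1 \<i>) / 2) * v"
      unfolding expand[of z v] sym[OF z] ii[OF z]
      by (simp add: complex_eq_iff field_simps)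
    qed
    finally show "(q has_derivative (\<lambda>v. cnj ((f'' z 1 1 + \<i> * f'' z 1 \<i>) / 2) * v)) (at z)" .
  qed auto
  then obtain g where g: "\<And>z. z \<in> ?D \<Longrightarrow> (g has_field_derivative q z) (at z within ?D)"
    using holomorphic_convex_primitive'[of ?D q] by auto
  have "\<exists>c. \<forall>z\<in>?D. f z - h z - cnj (g z) = c"
  proof (rule has_derivative_zero_constant)
    fix z assume z: "z \<in> ?D"
    have "((\<lambda>z. f z - h z - cnj (g z)) has_derivative (\<lambda>v. f' z v - p z * v - cnj (q z * v))) (at z within ?D)"
      using h[OF z] g[OF z] has_derivative_at_withinI[OF d1[OF z]]
      unfolding has_field_derivative_def
      by (intro derivative_intros has_derivative_cnj)
    also have "(\<lambda>v. f' z v - p z * v - cnj (q z * v)) = (\<lambda>v. 0)"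
    proof
      fix v show "f' z v - p z * v - cnj (q z * v) = 0"
      unfolding p_def q_def complex_linear_expand[of "f' z" v]
      by (simp add: complex_eq_iff field_simps)
    qed
    finally show "((\<lambda>z. f z - h z - cnj (g z)) has_derivative (\<lambda>v. 0)) (at z within ?D)" .
  qed auto
  then obtain c where c: "\<And>z. z \<in> ?D \<Longrightarrow> f z - h z - cnj (g z) = c" by blast
  have "harmonic_decomposition f (\<lambda>z. h z + c) g"
    unfolding harmonic_decomposition_def
  proof (intro conjI ballI)
    have "h holomorphic_on ?D" "g holomorphic_on ?D"
      using h g by (meson field_differentiable_def holomorphic_on_def)+
    then show "(\<lambda>z. h z + c) holomorphic_on ?D" "g holomorphic_on ?D"
      by (auto intro!: holomorphic_intros)
    show "f z = h z + c + cnj (g z)" if "z \<in> ?D" for z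
      using c[OF that] by (simp add: algebra_simps)
  qed
  then show ?thesis by blast
qed

section \<open>Lewy's theorem: the Jacobian of a univalent harmonic mapping does not vanish\<close>

text \<open>
  On a level set of Re $F$ the injectivity of $F$ is injectivity of Im $F$. If Im $F$ moves in the same
  direction along two radii inside this level set, then by the intermediate value theorem it takes a common
  value on both of them. The sign \<open>\<sigma>\<close> covers both directions in one statement.
\<close>

lemma two_level_arms_leave_in_opposite_directions:
  fixes F :: "complex \<Rightarrow> complex" and \<sigma> b :: real
  assumes cont: "continuous_on (cball 0 b) F" and inj: "inj_on F (cball 0 b)" and b: "b > 0"
    and d: "norm d = 1" "norm d' = 1" "d \<noteq> d'"
    and lev: "\<And>t. t \<in> {0..b} \<Longrightarrow> Re (F (of_real t * d)) = c" "\<And>t. t \<in> {0..b} \<Longrightarrow> Re (F (of_real t * d')) = c"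
    and up: "\<sigma> * (Im (F (of_real b * d)) - Im (F 0)) > 0" "\<sigma> * (Im (F (of_real b * d')) - Im (F 0)) > 0"
  shows False
proof -
  define u where "u e t = \<sigma> * (Im (F (of_real t * e)) - Im (F 0))" for e and t :: real
  define m where "m = min (u d b) (u d' b)"
  have "u d b > 0" "u d' b > 0" using up unfolding u_def .
  then have m: "m > 0" "m \<le> u d b" "m \<le> u d' b" by (auto simp: m_def)
  have reach: "\<exists>t. 0 < t \<and> t \<le> b \<and> u e t = m" if e: "norm e = 1" "m \<le> u e b" for e
  proof -
    have "continuous_on {0..b} (\<lambda>t. F (of_real t * e))"
      by (rule continuous_on_compose2[OF cont])
        (use e in \<open>auto intro!: continuous_intros simp: norm_mult\<close>)
    then have "continuous_on {0..b} (u e)"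
      unfolding u_def by (intro continuous_intros)
    moreover have "u e 0 \<le> m" using m by (simp add: u_def)
    ultimately obtain t where t: "0 \<le> t" "t \<le> b" "u e t = m"
      using IVT'[of "u e" 0 m b] e(2) b by auto
    moreover have "t \<noteq> 0" using t m by (auto simp: u_def)
    ultimately show ?thesis by (intro exI[of _ t]) simp
  qed
  obtain t where t: "0 < t" "t \<le> b" "u d t = m" using reach d m by blast
  obtain t' where t': "0 < t'" "t' \<le> b" "u d' t' = m" using reach d m by blast
  have "\<sigma> \<noteq> 0" using up by auto
  then have "Im (F (of_real t * d)) = Im (F (of_real t' * d'))"
    using t(3) t'(3) by (auto simp: u_def)
  moreover have "Re (F (of_real t * d)) = Re (F (of_real t' * d'))"
    using lev t t' by simp
  ultimately have "F (of_real t * d) = F (of_real t' * d')" by (simp add: complex_eq_iff)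
  moreover have "of_real t * d \<in> cball 0 b" "of_real t' * d' \<in> cball 0 b"
    using t t' d by (auto simp: norm_mult)
  ultimately have eq: "of_real t * d = of_real t' * d'" using inj by (auto dest: inj_onD)
  then have "norm (of_real t * d) = norm (of_real t' * d')" by simp
  then have "t = t'" using t t' d by (simp add: norm_mult)
  with eq t d show False by simp
qed

text \<open>
  Three radii have only two directions available on the line Re $= c$, so two of them use the same one.
\<close>

lemma no_level_triod:
  fixes F :: "complex \<Rightarrow> complex"
  assumes cont: "continuous_on (cball 0 b) F" and inj: "inj_on F (cball 0 b)" and b: "b > 0"
    and D: "card D = 3" "\<And>d. d \<in> D \<Longrightarrow> norm d = 1"
    and lev: "\<And>d t. d \<in> D \<Longrightarrow> t \<in> {0..b} \<Longrightarrow> Re (F (of_real t * d)) = c"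
  shows False
proof -
  obtain d1 d2 d3 where D3: "D = {d1, d2, d3}" "d1 \<noteq> d2" "d1 \<noteq> d3" "d2 \<noteq> d3"
    using D(1) by (auto simp: card_3_iff)
  define w where "w d = Im (F (of_real b * d)) - Im (F 0)" for d
  have nz: "w d \<noteq> 0" if "d \<in> D" for d
  proof
    assume "w d = 0"
    moreover have "Re (F (of_real b * d)) = c" "Re (F (of_real 0 * d)) = c" using lev[OF that] b by force+
    ultimately have "F (of_real b * d) = F 0" by (auto simp: w_def complex_eq_iff)
    moreover have "of_real b * d \<in> cball 0 b" "0 \<in> cball (0::complex) b" using b D(2)[OF that] by (auto simp: norm_mult)
    ultimately have "of_real b * d = 0" using inj by (auto dest: inj_onD)
    then show False using b D(2)[OF that] by auto
  qed
  have same: False if d: "d \<in> D" "d' \<in> D" "d \<noteq> d'" and up: "\<sigma> * w d > 0" "\<sigma> * w d' > 0" for d d' \<sigma>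
    by (rule two_level_arms_leave_in_opposite_directions[OF cont inj b D(2)[OF d(1)] D(2)[OF d(2)] d(3)
          lev[OF d(1)] lev[OF d(2)] up[unfolded w_def]])
  have in3: "d1 \<in> D" "d2 \<in> D" "d3 \<in> D" using D3 by auto
  have np: "\<not> (w d > 0 \<and> w d' > 0)" and nn: "\<not> (w d < 0 \<and> w d' < 0)"
    if "d \<in> D" "d' \<in> D" "d \<noteq> d'" for d d'
    using same[OF that, of 1] same[OF that, of "-1"] by auto
  have "w d > 0 \<or> w d < 0" if "d \<in> D" for d using nz[OF that] by linarith
  from this[OF in3(1)] this[OF in3(2)] this[OF in3(3)] show False
    using np[OF in3(1,2) D3(2)] np[OF in3(1,3) D3(3)] np[OF in3(2,3) D3(4)]
      nn[OF in3(1,2) D3(2)] nn[OF in3(1,3) D3(3)] nn[OF in3(2,3) D3(4)]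
    by argo
qed

lemma three_roots_of_imaginary_power:
  assumes "2 \<le> n"
  shows "\<exists>D::complex set. card D = 3 \<and> (\<forall>d\<in>D. norm d = 1 \<and> Re (d ^ n) = 0)"
proof -
  \<comment> \<open>The angles $\pi/2 + k\pi$ divided by $n$, for $k = 0, 1, 2$; they span at most $\pi$ because $n \<ge> 2$.\<close>
  define e where "e k = cis ((pi / 2 + k * pi) / n)" for k :: real
  have ne: "e i \<noteq> e j" if ij: "0 \<le> i" "i < j" "j \<le> 2" for i j
  proof
    assume eq: "e i = e j"
    let ?a = "(j - i) * pi / n"
    have "(pi / 2 + j * pi) / n - (pi / 2 + i * pi) / n = ?a"
      unfolding diff_divide_distrib[symmetric] by (simp add: left_diff_distrib)
    then have "cis ?a = e j / e i"
      by (simp only: e_def cis_divide)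
    then have "cis ?a = 1" using eq by (simp add: e_def)
    then have "cos ?a = 1" by (metis cis.sel(1) one_complex.sel(1))
    moreover have "(j - i) * pi \<le> n * pi" using ij assms by (intro mult_right_mono) auto
    then have "0 < ?a" "?a \<le> pi" using ij assms by (auto simp: divide_le_eq mult.commute)
    then have "cos ?a < cos 0" by (intro cos_monotone_0_pi) auto
    ultimately show False by simp
  qed
  have "card {e 0, e 1, e 2} = 3" using ne[of 0 1] ne[of 0 2] ne[of 1 2] by simp
  moreover have "Re (e k ^ n) = cos (pi / 2 + k * pi)" for k
    using assms by (simp add: e_def Complex.DeMoivre)
  then have "Re (e 0 ^ n) = 0" "Re (e 1 ^ n) = 0" "Re (e 2 ^ n) = 0"
    by (auto simp: cos_add)
  ultimately show ?thesis
    by (intro exI[of _ "{e 0, e 1, e 2}"]) (auto simp: e_def)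
qed

text \<open>
  At a critical point a nonconstant $\<phi>$ is $\<phi>(z_0) + \<psi>^n$ with $\<psi>$ a local conformal coordinate and
  $n \<ge> 2$. In this coordinate the level set of Re $\<phi>$ consists of the $2n \<ge> 4$ rays on which the $n$-th
  power is imaginary; three of them are used. The map \<open>\<eta>\<close> is the inverse of the coordinate.
  For constant $\<phi>$ any three radii in a disk about $z_0$ will do.
\<close>

lemma critical_level_set_contains_triod:
  assumes hol: "\<phi> holomorphic_on S" and S: "open S" "connected S" "z0 \<in> S" and crit: "deriv \<phi> z0 = 0"
  obtains \<eta> :: "complex \<Rightarrow> complex" and D b where "b > 0" "continuous_on (cball 0 b) \<eta>" "inj_on \<eta> (cball 0 b)" "\<eta> ` cball 0 b \<subseteq> S"
    "card D = 3" "\<And>d. d \<in> D \<Longrightarrow> norm d = 1"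
    "\<And>d t. d \<in> D \<Longrightarrow> t \<in> {0..b} \<Longrightarrow> Re (\<phi> (\<eta> (of_real t * d))) = Re (\<phi> z0)"
proof (cases "\<exists>w\<in>S. \<phi> w \<noteq> \<phi> z0")
  case False
  obtain r where r: "r > 0" "cball z0 r \<subseteq> S" using S open_contains_cball by blast
  obtain D :: "complex set" where D: "card D = 3" "\<And>d. d \<in> D \<Longrightarrow> norm d = 1"
    using three_roots_of_imaginary_power[of 2] by auto
  have sub: "(\<lambda>w. z0 + w) ` cball 0 r \<subseteq> S" using r by (auto simp: dist_norm)
  show ?thesis
  proof (rule that[of r "\<lambda>w. z0 + w" D])
    fix d t assume "d \<in> D" "t \<in> {0..r}"
    then have "of_real t * d \<in> cball 0 r" using D by (auto simp: norm_mult)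
    then have "z0 + of_real t * d \<in> S" using sub by blast
    then show "Re (\<phi> (z0 + of_real t * d)) = Re (\<phi> z0)" using False by auto
  qed (use r D sub in \<open>auto intro!: continuous_intros\<close>)
next
  case True
  then obtain w where w: "w \<in> S" "\<phi> w \<noteq> \<phi> z0" by blast
  obtain n where n: "n > 0" "(deriv ^^ n) \<phi> z0 \<noteq> 0" "\<And>i. 0 < i \<Longrightarrow> i < n \<Longrightarrow> (deriv ^^ i) \<phi> z0 = 0"
  proof -
    define P where "P n \<longleftrightarrow> 0 < n \<and> (deriv ^^ n) \<phi> z0 \<noteq> 0" for n
    have "\<exists>n. P n"
      using holomorphic_fun_eq_const_on_connected[OF hol S(1,2) _ S(3) w(1)] w(2) unfolding P_def by blast
    then have "P (LEAST n. P n)" by (meson LeastI_ex)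
    moreover have "\<not> P i" if "i < (LEAST n. P n)" for i using not_less_Least that by blast
    ultimately show ?thesis using that[of "LEAST n. P n"] unfolding P_def by blast
  qed
  have n2: "n \<ge> 2"
  proof (rule ccontr)
    assume "\<not> n \<ge> 2"
    with n have "n = 1" by simp
    with n crit show False by simp
  qed
  obtain g r where g: "0 < r" "g holomorphic_on ball z0 r"
    "\<And>w. w \<in> ball z0 r \<Longrightarrow> \<phi> w - \<phi> z0 = ((w - z0) * g w) ^ n"
    "\<And>w. w \<in> ball z0 r \<Longrightarrow> g w \<noteq> 0"
  proof (rule holomorphic_factor_order_of_zero_strong[OF hol S(1) S(3) n(1,2)])
    show "(deriv ^^ i) \<phi> z0 = 0" if "0 < i" "i < n" for i using n(3) that .
  qed (rule that)
  obtain r1 where r1: "r1 > 0" "ball z0 r1 \<subseteq> S" using S open_contains_ball by blast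
  define r2 where "r2 = min r r1"
  have r2: "r2 > 0" "ball z0 r2 \<subseteq> S" "ball z0 r2 \<subseteq> ball z0 r"
    using g r1 by (auto simp: r2_def)
  define \<psi> where "\<psi> w = (w - z0) * g w" for w
  have hol\<psi>: "\<psi> holomorphic_on ball z0 r2"
    unfolding \<psi>_def by (intro holomorphic_intros holomorphic_on_subset[OF g(2) r2(3)])
  have "g field_differentiable at z0"
    using g(1,2) by (meson centre_in_ball holomorphic_on_imp_differentiable_at open_ball)
  then have "(\<psi> has_field_derivative g z0) (at z0)"
    unfolding \<psi>_def field_differentiable_def by (auto intro!: derivative_eq_intros)
  then have "deriv \<psi> z0 \<noteq> 0" using g by (auto simp: DERIV_imp_deriv)
  then obtain r3 where r3: "r3 > 0" "ball z0 r3 \<subseteq> ball z0 r2" "open (\<psi> ` ball z0 r3)" "inj_on \<psi> (ball z0 r3)"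
    using has_complex_derivative_locally_invertible[OF hol\<psi> _ open_ball] r2(1) by (metis centre_in_ball)
  have hol3: "\<psi> holomorphic_on ball z0 r3" using hol\<psi> r3(2) by (rule holomorphic_on_subset)
  obtain \<eta> where chi: "\<eta> holomorphic_on (\<psi> ` ball z0 r3)" "\<And>z. z \<in> ball z0 r3 \<Longrightarrow> \<eta> (\<psi> z) = z"
    using holomorphic_has_inverse[OF hol3 open_ball r3(4)] by metis
  have "0 \<in> \<psi> ` ball z0 r3" using r3(1) by (auto simp: \<psi>_def intro!: image_eqI[of _ _ z0])
  then obtain b where b: "b > 0" "cball 0 b \<subseteq> \<psi> ` ball z0 r3" using r3(3) open_contains_cball by blast
  have chi_in: "\<eta> y \<in> ball z0 r3" "\<psi> (\<eta> y) = y" if "y \<in> cball 0 b" for y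
    using that b chi(2) by auto
  obtain D :: "complex set" where D: "card D = 3" "\<And>d. d \<in> D \<Longrightarrow> norm d = 1 \<and> Re (d ^ n) = 0"
    using three_roots_of_imaginary_power[OF n2] by auto
  show ?thesis
  proof (rule that[of b \<eta> D])
    show "continuous_on (cball 0 b) \<eta>"
      using b(2) chi(1) continuous_on_subset holomorphic_on_imp_continuous_on by blast
    show "inj_on \<eta> (cball 0 b)" by (metis chi_in(2) inj_onI)
    show "\<eta> ` cball 0 b \<subseteq> S" using chi_in(1) r3(2) r2(2) by blast
    fix d t assume d: "d \<in> D" and t: "t \<in> {0..b}"
    let ?y = "of_real t * d"
    have y: "?y \<in> cball 0 b" using D(2)[OF d] t by (auto simp: norm_mult)
    have "\<eta> ?y \<in> ball z0 r" using chi_in(1)[OF y] r3(2) r2(3) by blast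
    then have "\<phi> (\<eta> ?y) - \<phi> z0 = \<psi> (\<eta> ?y) ^ n"
      unfolding \<psi>_def by (rule g(3))
    also have "\<dots> = of_real (t ^ n) * d ^ n" using chi_in(2)[OF y] by (simp add: power_mult_distrib)
    finally have "Re (\<phi> (\<eta> ?y) - \<phi> z0) = t ^ n * Re (d ^ n)" by (metis Re_complex_of_real Im_complex_of_real times_complex.sel(1) mult_zero_left diff_zero)
    then show "Re (\<phi> (\<eta> ?y)) = Re (\<phi> z0)" using D(2)[OF d] by simp
  qed (use b D in auto)
qed

text \<open>
  If $|h'(z_0)| = |g'(z_0)|$, then the differential of $f = h + \bar g$ is degenerate at $z_0$: for a suitable unit
  number $e$ the real part of $e f$ has a critical point there. It is also the real part of the holomorphic
  $e h + \bar e g$, so its level set contains a triod, which $e f$ would map injectively into a line.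
\<close>

lemma lewy_univalent_harmonic:
  assumes hol: "h holomorphic_on S" "g holomorphic_on S" and S: "open S" "connected S" "z0 \<in> S"
    and inj: "inj_on (\<lambda>z. h z + cnj (g z)) S"
  shows "cmod (deriv h z0) \<noteq> cmod (deriv g z0)"
proof
  assume eq: "cmod (deriv h z0) = cmod (deriv g z0)"
  obtain e where e: "norm e = 1" "e * deriv h z0 + cnj e * deriv g z0 = 0"
  proof (cases "deriv h z0 = 0")
    case True
    then show ?thesis using eq that[of 1] by simp
  next
    case False
    \<comment> \<open>As $\bar e = 1/e$, the equation for $e$ is $e^2 = -g'(z_0)/h'(z_0)$.\<close>
    let ?e = "csqrt (- (deriv g z0 / deriv h z0))"
    have "deriv g z0 \<noteq> 0" using eq False by auto
    then have n: "norm ?e = 1" using eq by (simp add: norm_divide)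
    have "?e * ?e * cnj ?e = - (deriv g z0 / deriv h z0) * cnj ?e"
      by (metis power2_csqrt power2_eq_square)
    moreover have c1: "?e * cnj ?e = 1"
      using n by (metis complex_norm_square of_real_1 one_power2)
    ultimately have "?e = - (deriv g z0 / deriv h z0) * cnj ?e" by (simp add: mult.assoc)
    then have "?e * deriv h z0 = - cnj ?e * deriv g z0" using False
      by (metis (no_types, lifting) mult.commute mult_minus_left nonzero_mult_div_cancel_left times_divide_eq_left times_divide_eq_right)
    then show ?thesis using that[of ?e] n by simp
  qed
  define \<phi> where "\<phi> z = e * h z + cnj e * g z" for z
  define F where "F z = e * (h z + cnj (g z))" for z
  have re: "Re (F z) = Re (\<phi> z)" for z by (simp add: F_def \<phi>_def algebra_simps)
  have hol\<phi>: "\<phi> holomorphic_on S" unfolding \<phi>_def by (intro holomorphic_intros hol)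
  have fd: "h field_differentiable at z0" "g field_differentiable at z0"
    using hol S holomorphic_on_imp_differentiable_at by blast+
  have "(\<phi> has_field_derivative e * deriv h z0 + cnj e * deriv g z0) (at z0)"
    unfolding \<phi>_def
    by (intro DERIV_add DERIV_cmult field_differentiable_derivI fd)
  then have "deriv \<phi> z0 = 0"
    using e by (simp add: DERIV_imp_deriv)
  then obtain \<eta> :: "complex \<Rightarrow> complex" and D b where chi: "b > 0" "continuous_on (cball 0 b) \<eta>" "inj_on \<eta> (cball 0 b)" "\<eta> ` cball 0 b \<subseteq> S"
    and D: "card D = 3" "\<And>d. d \<in> D \<Longrightarrow> norm d = 1"
    and lev: "\<And>d t. d \<in> D \<Longrightarrow> t \<in> {0..b} \<Longrightarrow> Re (\<phi> (\<eta> (of_real t * d))) = Re (\<phi> z0)"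
  proof (rule critical_level_set_contains_triod[OF hol\<phi> S])
  qed (use that in auto)
  have "continuous_on S F"
    unfolding F_def using hol by (intro continuous_intros holomorphic_on_imp_continuous_on)
  then have "continuous_on (cball 0 b) (\<lambda>w. F (\<eta> w))"
    by (rule continuous_on_compose2) (use chi in auto)
  moreover have "inj_on (\<lambda>w. F (\<eta> w)) (cball 0 b)"
  proof (rule inj_onI)
    fix x y assume xy: "x \<in> cball 0 b" "y \<in> cball 0 b" "F (\<eta> x) = F (\<eta> y)"
    moreover have "e \<noteq> 0" using e by auto
    ultimately have "\<eta> x = \<eta> y" using inj chi(4) by (auto simp: F_def inj_on_def image_subset_iff)
    then show "x = y" using chi(3) xy by (auto dest: inj_onD)
  qed
  ultimately show False
    using no_level_triod[of b "\<lambda>w. F (\<eta> w)" D "Re (\<phi> z0)"] chi(1) D lev re by auto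
qed

section \<open>The affine invariant logarithmic derivative of the Jacobian\<close>

text \<open>
  The functions $h, g$ and their first two derivatives are separate arguments. Affine changes of $f$ and
  dilations of the disk then act on them by explicit formulas, without computing any iterated derivative.
\<close>

definition sense_preserving_jet ::
    "complex set \<Rightarrow> (complex \<Rightarrow> complex) \<Rightarrow> (complex \<Rightarrow> complex) \<Rightarrow> (complex \<Rightarrow> complex) \<Rightarrow>
     (complex \<Rightarrow> complex) \<Rightarrow> (complex \<Rightarrow> complex) \<Rightarrow> (complex \<Rightarrow> complex) \<Rightarrow> bool" where
  "sense_preserving_jet S h h1 h2 g g1 g2 \<longleftrightarrow>
     (\<forall>z\<in>S. (h has_field_derivative h1 z) (at z) \<and> (h1 has_field_derivative h2 z) (at z) \<and>
            (g has_field_derivative g1 z) (at z) \<and> (g1 has_field_derivative g2 z) (at z) \<and>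
            cmod (g1 z) < cmod (h1 z))"

text \<open>
  With $a_k = h^{(k)}(z)$ and $b_k = g^{(k)}(z)$ this is $\<partial>/\<partial>z \log J_f$ at $z$ for $f = h + \bar g$, the
  pre-Schwarzian derivative of a harmonic mapping. An invertible affine map of the plane multiplies $J_f$
  by a nonzero constant, so the value is the same for $f$ and for its images under such maps.
\<close>

definition jacobian_slope :: "complex \<Rightarrow> complex \<Rightarrow> complex \<Rightarrow> complex \<Rightarrow> complex" where
  "jacobian_slope a1 a2 b1 b2 = (a2 * cnj a1 - b2 * cnj b1) / (a1 * cnj a1 - b1 * cnj b1)"

lemma jetD:
  assumes "sense_preserving_jet S h h1 h2 g g1 g2" "z \<in> S"
  shows "(h has_field_derivative h1 z) (at z)" "(h1 has_field_derivative h2 z) (at z)"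
    "(g has_field_derivative g1 z) (at z)" "(g1 has_field_derivative g2 z) (at z)"
    "cmod (g1 z) < cmod (h1 z)" "h1 z \<noteq> 0"
  using assms by (force simp: sense_preserving_jet_def)+

lemma jet_subset:
  "sense_preserving_jet S h h1 h2 g g1 g2 \<Longrightarrow> T \<subseteq> S \<Longrightarrow> sense_preserving_jet T h h1 h2 g g1 g2"
  by (auto simp: sense_preserving_jet_def)

lemma jet_holomorphic:
  assumes "sense_preserving_jet S h h1 h2 g g1 g2" "open S"
  shows "h1 holomorphic_on S" "g1 holomorphic_on S" "h2 holomorphic_on S" "g2 holomorphic_on S"
proof -
  show h1: "h1 holomorphic_on S" and g1: "g1 holomorphic_on S"
    using jetD(2,4)[OF assms(1)] assms(2) unfolding holomorphic_on_open[OF assms(2)] by blast+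
  show "h2 holomorphic_on S"
    by (rule holomorphic_transform[OF holomorphic_deriv[OF h1 assms(2)]])
      (rule DERIV_imp_deriv[OF jetD(2)[OF assms(1)]])
  show "g2 holomorphic_on S"
    by (rule holomorphic_transform[OF holomorphic_deriv[OF g1 assms(2)]])
      (rule DERIV_imp_deriv[OF jetD(4)[OF assms(1)]])
qed

lemma jacobian_nonzero:
  assumes "cmod b1 < cmod a1"
  shows "a1 * cnj a1 - b1 * cnj b1 \<noteq> 0"
proof -
  have "(cmod b1)\<^sup>2 < (cmod a1)\<^sup>2" using assms by (simp add: power_strict_mono)
  then have "complex_of_real ((cmod a1)\<^sup>2 - (cmod b1)\<^sup>2) \<noteq> 0" by (simp only: of_real_eq_0_iff)
  then show ?thesis by (simp only: of_real_diff complex_norm_square not_False_eq_True)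
qed

text \<open>
  The quotients $b_1/a_1$ and $(b_2 a_1 - b_1 a_2)/a_1^2$ are the dilatation $\<omega> = g'/h'$ and its derivative,
  so the right-hand side is $h''/h' - \bar\<omega>\<omega>'/(1-|\<omega>|^2)$.
\<close>

lemma jacobian_slope_dilatation:
  assumes "cmod b1 < cmod a1"
  shows "jacobian_slope a1 a2 b1 b2 =
    a2 / a1 - cnj (b1 / a1) * ((b2 * a1 - b1 * a2) / a1\<^sup>2) / (1 - (cmod (b1 / a1))\<^sup>2)"
proof -
  define A B where "A = cnj a1" and "B = cnj b1"
  have nz: "a1 \<noteq> 0" "A \<noteq> 0" using assms by (auto simp: A_def)
  have J: "a1 * A - b1 * B \<noteq> 0" using jacobian_nonzero[OF assms] by (simp add: A_def B_def)
  have "complex_of_real (1 - (cmod (b1 / a1))\<^sup>2) = 1 - (b1 / a1) * (B / A)"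
    unfolding of_real_diff complex_norm_square by (simp add: A_def B_def)
  also have "\<dots> = (a1 * A - b1 * B) / (a1 * A)" using nz by (simp add: field_simps)
  finally have d: "complex_of_real (1 - (cmod (b1 / a1))\<^sup>2) = (a1 * A - b1 * B) / (a1 * A)" .
  have c: "cnj (b1 / a1) = B / A" by (simp add: A_def B_def)
  have "a2 / a1 - B / A * ((b2 * a1 - b1 * a2) / a1\<^sup>2) / ((a1 * A - b1 * B) / (a1 * A))
      = a2 / a1 - B * (b2 * a1 - b1 * a2) / (a1 * (a1 * A - b1 * B))"
    using nz by (simp add: power2_eq_square)
  also have "\<dots> = (a2 * (a1 * A - b1 * B) - B * (b2 * a1 - b1 * a2)) / (a1 * (a1 * A - b1 * B))"
  proof -
    have "a2 / a1 - Y / (a1 * J) = (a2 * J - Y) / (a1 * J)" if "J \<noteq> 0" for J Y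
      using nz that by (simp add: diff_divide_distrib)
    from this[OF J] show ?thesis .
  qed
  also have "a2 * (a1 * A - b1 * B) - B * (b2 * a1 - b1 * a2) = a1 * (a2 * A - b2 * B)"
    by (simp add: algebra_simps)
  also have "a1 * (a2 * A - b2 * B) / (a1 * (a1 * A - b1 * B)) = (a2 * A - b2 * B) / (a1 * A - b1 * B)"
    using nz by simp
  finally show ?thesis unfolding jacobian_slope_def c d by (simp add: A_def B_def)
qed

lemma deriv_bound_from_ball:
  assumes hol: "f holomorphic_on ball z R" and r: "0 < r" "r < R" and B: "\<And>x. x \<in> ball z R \<Longrightarrow> cmod (f x) \<le> B"
  shows "cmod (deriv f z) \<le> B / r"
proof -
  have sub: "cball z r \<subseteq> ball z R" using r by auto
  have "norm ((deriv ^^ 1) f z) \<le> fact 1 * B / r ^ 1"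
  proof (rule Cauchy_inequality)
    show "f holomorphic_on ball z r" using hol sub ball_subset_cball holomorphic_on_subset by blast
    show "continuous_on (cball z r) f"
      using hol sub continuous_on_subset holomorphic_on_imp_continuous_on by blast
    fix x assume "norm (z - x) = r"
    then have "x \<in> cball z r" by (simp add: dist_norm)
    then show "norm (f x) \<le> B" using B sub by blast
  qed (use r in auto)
  then show ?thesis by simp
qed

text \<open>
  When $\<omega>(z_0) = 0$, Schwarz's lemma makes $\<omega>$ small near $z_0$ and Cauchy's inequality makes $\<omega>'$ at most of order
  $1/r$. Hence $g'$ is small compared with $h'$, and $h''/h'$ is close to the affine invariant
  quantity $\<partial>/\<partial>z \log J_f$: up to an error of order $1/r$ the mapping behaves like the holomorphic $h$.
\<close>

lemma normalized_jet_estimates: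
  assumes jet: "sense_preserving_jet (ball z0 r) h h1 h2 g g1 g2" and r: "r > 0" and g0: "g1 z0 = 0"
    and z: "z \<in> ball z0 (r / 2)"
  shows "cmod (g1 z) \<le> cmod (z - z0) / r * cmod (h1 z)"
    and "cmod (h2 z / h1 z - jacobian_slope (h1 z) (h2 z) (g1 z) (g2 z)) \<le> 2 / r"
proof -
  define \<omega> where "\<omega> z = g1 z / h1 z" for z
  have hol: "\<omega> holomorphic_on ball z0 r"
    unfolding \<omega>_def using jet_holomorphic[OF jet open_ball] jetD(6)[OF jet] by (intro holomorphic_intros)
  have lt1: "cmod (\<omega> x) < 1" if "x \<in> ball z0 r" for x
    using jetD(5,6)[OF jet that] by (simp add: \<omega>_def norm_divide)
  have zr: "z \<in> ball z0 r" using z r by auto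
  have dz: "cmod (z - z0) < r / 2" using z by (simp add: dist_norm norm_minus_commute)
  define \<Phi> where "\<Phi> \<zeta> = \<omega> (z0 + of_real r * \<zeta>)" for \<zeta>
  have maps: "z0 + of_real r * \<zeta> \<in> ball z0 r" if "norm \<zeta> < 1" for \<zeta>
    using that r by (simp add: dist_norm norm_mult)
  have "\<Phi> holomorphic_on ball 0 1"
    unfolding \<Phi>_def
    by (rule holomorphic_on_compose_gen[OF _ hol, unfolded o_def])
      (use maps in \<open>auto intro!: holomorphic_intros\<close>)
  moreover have "\<Phi> 0 = 0" by (simp add: \<Phi>_def \<omega>_def g0)
  moreover have "norm (\<Phi> \<zeta>) < 1" if "norm \<zeta> < 1" for \<zeta>
    unfolding \<Phi>_def using lt1 maps that by blast
  moreover have "norm ((z - z0) / of_real r) < 1" using dz r by (simp add: norm_divide)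
  ultimately have "norm (\<Phi> ((z - z0) / of_real r)) \<le> norm ((z - z0) / of_real r)"
    by (rule Schwarz_Lemma(1))
  then have w: "cmod (\<omega> z) \<le> cmod (z - z0) / r" using r by (simp add: \<Phi>_def norm_divide)
  then show "cmod (g1 z) \<le> cmod (z - z0) / r * cmod (h1 z)"
    using jetD(6)[OF jet zr] by (simp add: \<omega>_def norm_divide pos_divide_le_eq)
  have "cmod (z - z0) / r \<le> 1 / 2" using dz r by (simp add: divide_le_eq)
  with w have wh: "cmod (\<omega> z) \<le> 1 / 2" by linarith
  define W where "W = (g2 z * h1 z - g1 z * h2 z) / (h1 z)\<^sup>2"
  have "(\<omega> has_field_derivative W) (at z)"
    unfolding \<omega>_def W_def power2_eq_square
    by (rule DERIV_divide jetD[OF jet zr])+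
  then have dW: "deriv \<omega> z = W" by (rule DERIV_imp_deriv)
  have sub: "ball z (r / 2) \<subseteq> ball z0 r"
  proof
    fix x assume "x \<in> ball z (r / 2)"
    then show "x \<in> ball z0 r" using z dist_triangle[of z0 x z] by (simp add: dist_commute)
  qed
  have "cmod (deriv \<omega> z) \<le> 1 / (r / 3)"
  proof (rule deriv_bound_from_ball[where R = "r / 2"])
    show "\<omega> holomorphic_on ball z (r / 2)" using hol sub by (rule holomorphic_on_subset)
    show "cmod (\<omega> x) \<le> 1" if "x \<in> ball z (r / 2)" for x using lt1 sub that by (meson less_imp_le subsetD)
  qed (use r in auto)
  then have Wb: "cmod W \<le> 3 / r" using dW by simp
  have "(cmod (\<omega> z))\<^sup>2 \<le> (1 / 2)\<^sup>2" using wh by (intro power_mono) auto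
  then have den: "1 - (cmod (\<omega> z))\<^sup>2 \<ge> 3 / 4" by (simp add: power2_eq_square)
  have "h2 z / h1 z - jacobian_slope (h1 z) (h2 z) (g1 z) (g2 z)
      = cnj (\<omega> z) * W / of_real (1 - (cmod (\<omega> z))\<^sup>2)"
    unfolding jacobian_slope_dilatation[OF jetD(5)[OF jet zr]] by (simp add: \<omega>_def W_def)
  then have "cmod (h2 z / h1 z - jacobian_slope (h1 z) (h2 z) (g1 z) (g2 z))
      = cmod (\<omega> z) * cmod W / (1 - (cmod (\<omega> z))\<^sup>2)"
    using den by (simp add: norm_divide norm_mult del: of_real_diff of_real_power)
  also have "\<dots> \<le> (1 / 2) * (3 / r) / (3 / 4)"
    using wh Wb den r by (intro frac_le mult_mono) auto
  also have "\<dots> \<le> 2 / r" using r by (simp add: field_simps)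
  finally show "cmod (h2 z / h1 z - jacobian_slope (h1 z) (h2 z) (g1 z) (g2 z)) \<le> 2 / r" .
qed

text \<open>
  The difference of the squares is $(1-|a|^2)(|x|^2-|y|^2)$: the Jacobian of the affine map
  $w \<mapsto> w - \bar a \bar w$ times that of $f$.
\<close>

lemma affine_norm_mono:
  assumes "cmod a < 1" "cmod y < cmod x"
  shows "cmod (y - a * x) < cmod (x - cnj a * y)"
proof -
  have "(cmod (x - cnj a * y))\<^sup>2 - (cmod (y - a * x))\<^sup>2 = (1 - (cmod a)\<^sup>2) * ((cmod x)\<^sup>2 - (cmod y)\<^sup>2)"
  proof -
    have "complex_of_real ((cmod (x - cnj a * y))\<^sup>2 - (cmod (y - a * x))\<^sup>2)
        = complex_of_real ((1 - (cmod a)\<^sup>2) * ((cmod x)\<^sup>2 - (cmod y)\<^sup>2))"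
      unfolding of_real_diff of_real_mult complex_norm_square by (simp add: algebra_simps)
    then show ?thesis by (simp only: of_real_eq_iff)
  qed
  moreover have "(cmod a)\<^sup>2 < 1" using assms(1) by (simp add: power_less_one_iff abs_square_less_1)
  moreover have "(cmod y)\<^sup>2 < (cmod x)\<^sup>2" using assms(2) by (simp add: power_strict_mono)
  ultimately have "(cmod (y - a * x))\<^sup>2 < (cmod (x - cnj a * y))\<^sup>2"
    by (smt (verit) mult_pos_pos)
  then show ?thesis by (simp add: power_less_imp_less_base)
qed

text \<open>
  The pair belongs to $(f - \bar a \bar f)/A$. The choice $a = \<omega>(z_0)$ makes the dilatation vanish at $z_0$, and $A$
  normalizes the derivative of the holomorphic part.
\<close>

lemma jet_affine:
  assumes jet: "sense_preserving_jet S h h1 h2 g g1 g2" and a: "cmod a < 1" and A: "A \<noteq> 0"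
  shows "sense_preserving_jet S
    (\<lambda>z. (h z - cnj a * g z) / A) (\<lambda>z. (h1 z - cnj a * g1 z) / A) (\<lambda>z. (h2 z - cnj a * g2 z) / A)
    (\<lambda>z. (g z - a * h z) / cnj A) (\<lambda>z. (g1 z - a * h1 z) / cnj A) (\<lambda>z. (g2 z - a * h2 z) / cnj A)"
  unfolding sense_preserving_jet_def
proof (intro ballI conjI)
  fix z assume z: "z \<in> S"
  note j = jetD[OF jet z]
  show "cmod ((g1 z - a * h1 z) / cnj A) < cmod ((h1 z - cnj a * g1 z) / A)"
    using affine_norm_mono[OF a j(5)] A by (simp add: norm_divide divide_strict_right_mono)
qed (intro DERIV_cdivide DERIV_diff DERIV_cmult jetD[OF jet]; assumption)+

lemma inj_affine:
  assumes inj: "inj_on (\<lambda>z. h z + cnj (g z)) S" and a: "cmod a < 1" and A: "A \<noteq> 0"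
  shows "inj_on (\<lambda>z. (h z - cnj a * g z) / A + cnj ((g z - a * h z) / cnj A)) S"
proof (rule inj_onI)
  fix x y assume xy: "x \<in> S" "y \<in> S"
    and eq: "(h x - cnj a * g x) / A + cnj ((g x - a * h x) / cnj A) = (h y - cnj a * g y) / A + cnj ((g y - a * h y) / cnj A)"
  let ?f = "\<lambda>z. h z + cnj (g z)"
  have e: "(h z - cnj a * g z) / A + cnj ((g z - a * h z) / cnj A) = (?f z - cnj a * cnj (?f z)) / A" for z
    by (simp add: diff_divide_distrib add_divide_distrib ring_distribs)
  define d where "d = ?f x - ?f y"
  have "?f x - cnj a * cnj (?f x) = ?f y - cnj a * cnj (?f y)"
    using eq A unfolding e by simp
  then have "d = cnj a * cnj d" by (simp add: d_def algebra_simps)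
  then have "cmod d = cmod a * cmod d" by (metis complex_mod_cnj norm_mult)
  then have "d = 0" using a by simp
  then show "x = y" using inj xy by (auto simp: d_def dest: inj_onD)
qed

lemma jacobian_slope_affine:
  assumes a: "cmod a < 1" and A: "A \<noteq> 0"
  shows "jacobian_slope ((x1 - cnj a * y1) / A) ((x2 - cnj a * y2) / A) ((y1 - a * x1) / cnj A) ((y2 - a * x2) / cnj A)
    = jacobian_slope x1 x2 y1 y2"
proof -
  have k: "1 - a * cnj a \<noteq> 0" using jacobian_nonzero[of a 1] a by simp
  have num: "(x2 - cnj a * y2) / A * cnj ((x1 - cnj a * y1) / A) - (y2 - a * x2) / cnj A * cnj ((y1 - a * x1) / cnj A)
      = (1 - a * cnj a) / (A * cnj A) * (x2 * cnj x1 - y2 * cnj y1)" for x2 y2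
  proof -
    have "X / A * (Y / cnj A) - Z / cnj A * (W / A) = (X * Y - Z * W) / (A * cnj A)" for X Y Z W
      by (simp add: diff_divide_distrib mult.commute)
    moreover have "(x2 - cnj a * y2) * (cnj x1 - a * cnj y1) - (y2 - a * x2) * (cnj y1 - cnj a * cnj x1)
        = (1 - a * cnj a) * (x2 * cnj x1 - y2 * cnj y1)"
      by (simp add: algebra_simps)
    ultimately show ?thesis by simp
  qed
  show ?thesis unfolding jacobian_slope_def num using k A by simp
qed

lemma jet_dilate:
  assumes jet: "sense_preserving_jet S h h1 h2 g g1 g2" and l: "l > 0"
    and T: "\<And>x. x \<in> T \<Longrightarrow> z0 + of_real l * x \<in> S"
  shows "sense_preserving_jet T
    (\<lambda>x. h (z0 + of_real l * x) / of_real l) (\<lambda>x. h1 (z0 + of_real l * x)) (\<lambda>x. of_real l * h2 (z0 + of_real l * x))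
    (\<lambda>x. g (z0 + of_real l * x) / of_real l) (\<lambda>x. g1 (z0 + of_real l * x)) (\<lambda>x. of_real l * g2 (z0 + of_real l * x))"
  unfolding sense_preserving_jet_def
proof (intro ballI conjI)
  fix x assume x: "x \<in> T"
  note j = jetD[OF jet T[OF x]]
  have ch: "((\<lambda>x. u (z0 + of_real l * x)) has_field_derivative u' * of_real l) (at x)"
    if "(u has_field_derivative u') (at (z0 + of_real l * x))" for u u'
    by (rule DERIV_chain2[where g = "\<lambda>x. z0 + of_real l * x", OF that]) (auto intro!: derivative_eq_intros)
  show "cmod (g1 (z0 + of_real l * x)) < cmod (h1 (z0 + of_real l * x))" by (rule j(5))
  show "((\<lambda>x. h1 (z0 + of_real l * x)) has_field_derivative of_real l * h2 (z0 + of_real l * x)) (at x)"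
    using ch[OF j(2)] by (simp add: mult.commute)
  show "((\<lambda>x. g1 (z0 + of_real l * x)) has_field_derivative of_real l * g2 (z0 + of_real l * x)) (at x)"
    using ch[OF j(4)] by (simp add: mult.commute)
  show "((\<lambda>x. h (z0 + of_real l * x) / of_real l) has_field_derivative h1 (z0 + of_real l * x)) (at x)"
    using DERIV_cdivide[OF ch[OF j(1)], of "of_real l"] l by simp
  show "((\<lambda>x. g (z0 + of_real l * x) / of_real l) has_field_derivative g1 (z0 + of_real l * x)) (at x)"
    using DERIV_cdivide[OF ch[OF j(3)], of "of_real l"] l by simp
qed

lemma inj_dilate:
  fixes z0 :: complex
  assumes inj: "inj_on (\<lambda>z. h z + cnj (g z)) S" and l: "l > 0"
    and T: "\<And>x. x \<in> T \<Longrightarrow> z0 + of_real l * x \<in> S"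
  shows "inj_on (\<lambda>x. h (z0 + of_real l * x) / of_real l + cnj (g (z0 + of_real l * x) / of_real l)) T"
proof (rule inj_onI)
  fix x y assume xy: "x \<in> T" "y \<in> T"
    "h (z0 + of_real l * x) / of_real l + cnj (g (z0 + of_real l * x) / of_real l)
      = h (z0 + of_real l * y) / of_real l + cnj (g (z0 + of_real l * y) / of_real l)"
  then have "h (z0 + of_real l * x) + cnj (g (z0 + of_real l * x)) = h (z0 + of_real l * y) + cnj (g (z0 + of_real l * y))"
    using l by (simp add: add_divide_distrib[symmetric])
  then have "z0 + of_real l * x = z0 + of_real l * y"
    using inj T xy(1,2) by (auto dest: inj_onD)
  then show "x = y" using l by simp
qed

lemma jacobian_slope_dilate:
  "jacobian_slope a1 (l * a2) b1 (l * b2) = l * jacobian_slope a1 a2 b1 b2"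
  by (simp add: jacobian_slope_def algebra_simps)

section \<open>The exponential as the blow-up limit\<close>

lemma fixed_derivative_bound:
  assumes "\<And>x. x \<in> cball 0 L \<Longrightarrow> (f has_field_derivative f' x) (at x)"
    and "\<And>x. x \<in> cball 0 L \<Longrightarrow> cmod (f' x) \<le> B" and z: "z \<in> cball 0 L" and "B \<ge> 0"
  shows "cmod (f z - f 0) \<le> B * L"
proof -
  have L: "L \<ge> 0" using z by (metis cball_eq_empty empty_iff not_le)
  have "cmod (f z - f 0) \<le> B * cmod (z - 0)"
    by (rule field_differentiable_bound[where S = "cball 0 L"])
      (use assms L in \<open>auto intro: has_field_derivative_at_within\<close>)
  also have "\<dots> \<le> B * L" using z assms(4) by (intro mult_left_mono) auto
  finally show ?thesis .
qed

text \<open>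
  A logarithmic derivative close to a constant $c$ integrates to a function close to $\exp(cz)$: with
  $q' = k'/k - c$ and $q(0)=0$ one has $k = \exp(cz + q)$.
\<close>

lemma exponential_from_log_derivative:
  assumes R: "0 < L" "L < R"
    and der: "\<And>z. z \<in> ball 0 R \<Longrightarrow> (k has_field_derivative k' z) (at z)"
    and hol: "k' holomorphic_on ball 0 R" and nz: "\<And>z. z \<in> ball 0 R \<Longrightarrow> k z \<noteq> 0" and k0: "k 0 = 1"
    and near: "\<And>z. z \<in> cball 0 L \<Longrightarrow> cmod (k' z / k z - c) \<le> \<epsilon>" and \<epsilon>: "0 \<le> \<epsilon>" "\<epsilon> * L \<le> 1 / 2"
    and c: "cmod c = 1" and z: "z \<in> cball 0 L"
  shows "cmod (k z - exp (c * z)) \<le> exp L * (2 * \<epsilon> * L)"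
proof -
  let ?D = "ball (0::complex) R"
  have "k holomorphic_on ?D" using der unfolding holomorphic_on_open[OF open_ball] by blast
  then have holk: "(\<lambda>z. k' z / k z - c) holomorphic_on ?D"
    using hol nz by (intro holomorphic_intros)
  then obtain q0 where q0: "\<And>z. z \<in> ?D \<Longrightarrow> (q0 has_field_derivative k' z / k z - c) (at z within ?D)"
    using holomorphic_convex_primitive'[OF convex_ball open_ball holk] by blast
  define q where "q z = q0 z - q0 0" for z
  have q: "(q has_field_derivative k' z / k z - c) (at z)" if "z \<in> ?D" for z
    using q0[OF that] that unfolding q_def
    by (auto intro!: derivative_eq_intros simp: at_within_open[of _ ?D])
  have sub: "cball 0 L \<subseteq> ?D" using R by auto
  \<comment> \<open>The quotient of $k$ and $\exp(cz + q)$ has derivative zero.\<close>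
  have "\<exists>C. \<forall>z\<in>?D. k z * exp (- (c * z + q z)) = C"
  proof (rule has_field_derivative_zero_constant)
    fix z assume z: "z \<in> ?D"
    have "((\<lambda>z. k z * exp (- (c * z + q z))) has_field_derivative
        k' z * exp (- (c * z + q z)) + k z * (exp (- (c * z + q z)) * - (c + (k' z / k z - c)))) (at z)"
      by (rule derivative_eq_intros der[OF z] q[OF z] refl | simp)+
    moreover have "k' z * exp (- (c * z + q z)) + k z * (exp (- (c * z + q z)) * - (c + (k' z / k z - c))) = 0"
      using nz[OF z] by simp
    ultimately show "((\<lambda>z. k z * exp (- (c * z + q z))) has_field_derivative 0) (at z within ?D)"
      by (metis has_field_derivative_at_within)
  qed simp
  then obtain C where C: "\<And>z. z \<in> ?D \<Longrightarrow> k z * exp (- (c * z + q z)) = C" by blast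
  have "0 \<in> ?D" using R by simp
  from C[OF this] have "C = 1" by (simp add: k0 q_def)
  have zD: "z \<in> ?D" using z sub by blast
  have "k z * exp (- (c * z + q z)) = 1" using C[OF zD] \<open>C = 1\<close> by simp
  moreover have "k z = k z * exp (- s) * exp s" for s by (simp add: exp_minus)
  ultimately have kz: "k z = exp (c * z) * exp (q z)"
    by (metis exp_add mult_1_left)
  have "cmod (q z - q 0) \<le> \<epsilon> * L"
    by (rule fixed_derivative_bound[OF q near z \<epsilon>(1)]) (use sub in auto)
  then have qz: "cmod (q z) \<le> \<epsilon> * L" by (simp add: q_def)
  then have "cmod (exp (q z) - 1) \<le> 3 / 2 * cmod (q z)"
    using \<epsilon> by (intro norm_exp_bounds(2)) linarith
  with qz have e1: "cmod (exp (q z) - 1) \<le> 2 * \<epsilon> * L" using norm_ge_zero[of "q z"] by linarith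
  have "cmod (exp (c * z)) \<le> exp (cmod (c * z))" by (rule norm_exp)
  also have "\<dots> \<le> exp L" using z c by (simp add: norm_mult)
  finally have e2: "cmod (exp (c * z)) \<le> exp L" .
  have "k z - exp (c * z) = exp (c * z) * (exp (q z) - 1)" by (simp add: kz algebra_simps)
  then have "cmod (k z - exp (c * z)) = cmod (exp (c * z)) * cmod (exp (q z) - 1)" by (simp add: norm_mult)
  also have "\<dots> \<le> exp L * (2 * \<epsilon> * L)" using e1 e2 by (intro mult_mono) auto
  finally show ?thesis .
qed

text \<open>
  The model $(\exp(cz)-1)/c$ vanishes at $0$ and at its period $p = 2\pi i/c$. The second zero survives a small
  perturbation: near $p$, the equation $F(b) = F(0)$ is a fixed point equation for the map
  $b \<mapsto> p + \mathrm{Ln}(1 - c\,\mathrm{err}(b))/c$, which sends a closed disk about $p$ into itself, so Brouwer's theorem solves it.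
  The radius $9$ exceeds $2\pi + 1$.
\<close>

lemma perturbed_exponential_not_injective:
  assumes c: "cmod c = 1" and cont: "continuous_on (cball 0 9) F"
    and near: "\<And>z. z \<in> cball 0 9 \<Longrightarrow> cmod (F z - F 0 - (exp (c * z) - 1) / c) < 1 / 2"
  shows "\<not> inj_on F (cball 0 9)"
proof -
  have c0: "c \<noteq> 0" using c by auto
  define err where "err z = F z - F 0 - (exp (c * z) - 1) / c" for z
  define p where "p = 2 * of_real pi * \<i> / c"
  have np: "cmod p = 2 * pi" using c by (simp add: p_def norm_divide norm_mult)
  have sub: "cball p 1 \<subseteq> cball 0 9"
  proof
    fix x assume "x \<in> cball p 1"
    then have "cmod (x - p) \<le> 1" by (simp add: dist_norm norm_minus_commute)
    then have "cmod x \<le> 2 * pi + 1" using norm_triangle_ineq[of "x - p" p] np by simp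
    then show "x \<in> cball 0 9" using pi_less_4 by simp
  qed
  define T where "T z = p + Ln (1 + - (c * err z)) / c" for z
  have small: "cmod (- (c * err z)) < 1 / 2" if "z \<in> cball p 1" for z
  proof -
    have "z \<in> cball 0 9" using that sub by blast
    from near[OF this] show ?thesis using c by (simp add: norm_mult err_def)
  qed
  have Repos: "Re (1 + - (c * err z)) > 0" if "z \<in> cball p 1" for z
    using small[OF that] abs_Re_le_cmod[of "- (c * err z)"] by auto
  have "continuous_on (cball p 1) F" using cont sub by (rule continuous_on_subset)
  then have "continuous_on (cball p 1) err"
    unfolding err_def using c0 by (intro continuous_intros) auto
  moreover have "1 + - (c * err z) \<notin> \<real>\<^sub>\<le>\<^sub>0" if "z \<in> cball p 1" for z
    using Repos[OF that] by (metis complex_nonpos_Reals_iff leD)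
  ultimately have "continuous_on (cball p 1) T"
    unfolding T_def using c0 by (intro continuous_intros) auto
  moreover have "T \<in> cball p 1 \<rightarrow> cball p 1"
  proof
    fix z assume z: "z \<in> cball p 1"
    have "cmod (T z - p) = cmod (Ln (1 + - (c * err z)))" using c by (simp add: T_def norm_divide)
    also have "\<dots> \<le> 2 * cmod (- (c * err z))" by (rule norm_Ln_le[OF small[OF z]])
    also have "\<dots> \<le> 1" using small[OF z] by linarith
    finally show "T z \<in> cball p 1" by (simp add: dist_norm norm_minus_commute)
  qed
  ultimately obtain b where b: "b \<in> cball p 1" "T b = b"
    using brouwer[of "cball p 1" T] by (auto simp del: mem_cball)
  have "c * b = 2 * of_real pi * \<i> + Ln (1 + - (c * err b))"
  proof -
    \<comment> \<open>Multiplied by $c$, the fixed point equation is one for the exponent,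
      so that exponentiating gives $\exp(cb) = 1 - c\,\mathrm{err}(b)$.\<close>
    have "c * T b = 2 * of_real pi * \<i> + Ln (1 + - (c * err b))"
      using c0 by (simp add: T_def p_def ring_distribs)
    then show ?thesis using b(2) by simp
  qed
  then have "exp (c * b) = exp (2 * of_real pi * \<i>) * exp (Ln (1 + - (c * err b)))"
    by (simp only: exp_add)
  also have "\<dots> = 1 + - (c * err b)"
  proof -
    have "1 + - (c * err b) \<noteq> 0" using Repos[OF b(1)] by (metis less_irrefl zero_complex.sel(1))
    then show ?thesis by (simp only: exp_Ln exp_two_pi_i mult_1_left not_False_eq_True)
  qed
  finally have "(exp (c * b) - 1) / c = - err b" using c0 by (simp add: field_simps)
  then have "F b = F 0" by (simp add: err_def)
  moreover have "b \<noteq> 0"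
  proof
    assume "b = 0"
    then have "cmod p \<le> 1" using b(1) by (simp add: dist_norm)
    then show False using np pi_gt3 by simp
  qed
  moreover have "b \<in> cball 0 9" "0 \<in> cball (0::complex) 9" using b sub by auto
  ultimately show ?thesis by (metis inj_onD)
qed

text \<open>
  Large enough for the comparison with the exponential: on the disk of radius $9$ the error there is at
  most $17658\, e^9/R$, which is below $1/2$ for this value of $R$.
\<close>

definition blow_up_radius :: real where
  "blow_up_radius = 40000 * exp 9"

lemma blow_up_radius_ge: "blow_up_radius \<ge> 40000"
  by (simp add: blow_up_radius_def)

text \<open>
  On half of the disk $Q = h''/h'$ is bounded by $3$, so by Cauchy's inequality $Q'$ is of order $1/R$, and $Q$ is almost equal
  to the unimodular constant $c = Q(0)$ on the disk of radius $9$. Thus $h'$ is close to $\exp(cz)$ and $g'$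
  is close to $0$, and $f$ is close to the periodic function $(\exp(cz)-1)/c$ up to an additive constant.
\<close>

lemma no_large_normalized_univalent_jet:
  assumes jet: "sense_preserving_jet (ball 0 blow_up_radius) h h1 h2 g g1 g2"
    and inj: "inj_on (\<lambda>z. h z + cnj (g z)) (ball 0 blow_up_radius)"
    and norm: "h1 0 = 1" "g1 0 = 0" "cmod (h2 0) = 1"
    and slope: "\<And>z. z \<in> ball 0 blow_up_radius \<Longrightarrow> cmod (jacobian_slope (h1 z) (h2 z) (g1 z) (g2 z)) \<le> 2"
  shows False
proof -
  define R where "R = blow_up_radius"
  note jet = jet[folded R_def] and inj = inj[folded R_def] and slope = slope[folded R_def]
  have R: "R \<ge> 40000" using blow_up_radius_ge by (simp add: R_def)
  have R2: "exp 9 / R = 1 / 40000" by (simp add: R_def blow_up_radius_def)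
  define c where "c = h2 0"
  have c: "cmod c = 1" using norm by (simp add: c_def)
  define Q where "Q z = h2 z / h1 z" for z
  have holQ: "Q holomorphic_on ball 0 R"
    unfolding Q_def using jet_holomorphic[OF jet open_ball] jetD(6)[OF jet] by (intro holomorphic_intros)
  have near: "z \<in> ball 0 (R / 2)" "z \<in> ball 0 R" if "z \<in> cball (0::complex) 9" for z using that R by auto
  have Q3: "cmod (Q z) \<le> 3" if z: "z \<in> ball 0 (R / 2)" for z
  proof -
    have zR: "z \<in> ball 0 R" using z R by auto
    have "cmod (Q z - jacobian_slope (h1 z) (h2 z) (g1 z) (g2 z)) \<le> 2 / R"
      unfolding Q_def using normalized_jet_estimates(2)[OF jet _ norm(2) z] R by simp
    moreover have "2 / R \<le> 1" using R by simp
    ultimately show ?thesis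
      using slope[OF zR] norm_triangle_sub[of "Q z" "jacobian_slope (h1 z) (h2 z) (g1 z) (g2 z)"] by linarith
  qed
  have dQ: "cmod (deriv Q z) \<le> 12 / R" if z: "z \<in> cball 0 9" for z
  proof -
    have sub: "ball z (R / 3) \<subseteq> ball 0 (R / 2)"
    proof
      fix x assume "x \<in> ball z (R / 3)"
      then have "cmod (x - z) < R / 3" by (simp add: dist_norm norm_minus_commute)
      then have "cmod x < R / 3 + 9" using norm_triangle_ineq[of "x - z" z] z by simp
      then show "x \<in> ball 0 (R / 2)" using R by simp
    qed
    have "ball 0 (R / 2) \<subseteq> ball (0::complex) R" using R by auto
    then have "Q holomorphic_on ball z (R / 3)" using holQ sub holomorphic_on_subset by (metis order_trans)
    then have "cmod (deriv Q z) \<le> 3 / (R / 4)"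
      by (rule deriv_bound_from_ball) (use R Q3 sub in auto)
    then show ?thesis by simp
  qed
  have Qc: "cmod (Q z - c) \<le> 108 / R" if z: "z \<in> cball 0 9" for z
  proof -
    have "cmod (Q z - Q 0) \<le> 12 / R * 9"
    proof (rule fixed_derivative_bound[OF _ dQ z])
      fix x :: complex assume "x \<in> cball 0 9"
      then show "(Q has_field_derivative deriv Q x) (at x)"
        using holomorphic_derivI[OF holQ open_ball near(2)] by simp
    qed (use R in auto)
    then show ?thesis by (simp add: Q_def c_def norm)
  qed
  have h1exp: "cmod (h1 z - exp (c * z)) \<le> 1944 / 40000" if z: "z \<in> cball 0 9" for z
  proof -
    have "cmod (h1 z - exp (c * z)) \<le> exp 9 * (2 * (108 / R) * 9)"
      by (rule exponential_from_log_derivative[where k' = h2 and R = R])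
        (use R jetD(2,6)[OF jet] jet_holomorphic[OF jet open_ball] norm Qc c z in \<open>auto simp: Q_def\<close>)
    also have "\<dots> = 1944 * (exp 9 / R)" by simp
    finally show ?thesis by (simp add: R2)
  qed
  have h1b: "cmod (h1 z) \<le> 2 * exp 9" if z: "z \<in> cball 0 9" for z
  proof -
    have "cmod (exp (c * z)) \<le> exp (cmod (c * z))" by (rule norm_exp)
    also have "\<dots> \<le> exp 9" using z c by (simp add: norm_mult)
    finally have "cmod (exp (c * z)) \<le> exp 9" .
    moreover have "(1::real) \<le> exp 9" by simp
    ultimately show ?thesis
      using h1exp[OF z] norm_triangle_sub[of "h1 z" "exp (c * z)"] by linarith
  qed
  have g1b: "cmod (g1 z) \<le> 18 / 40000" if z: "z \<in> cball 0 9" for z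
  proof -
    have "cmod (g1 z) \<le> cmod (z - 0) / R * cmod (h1 z)"
      using normalized_jet_estimates(1)[OF jet _ norm(2) near(1)[OF z]] R by simp
    also have "\<dots> \<le> 9 / R * (2 * exp 9)"
      using z h1b[OF z] R by (intro mult_mono divide_right_mono) auto
    also have "\<dots> = 18 * (exp 9 / R)" by simp
    finally show ?thesis by (simp add: R2)
  qed
  define F where "F z = h z + cnj (g z)" for z
  have "\<not> inj_on F (cball 0 9)"
  proof (rule perturbed_exponential_not_injective[OF c])
    have "continuous_on (cball 0 9) h" "continuous_on (cball 0 9) g"
      by (intro continuous_at_imp_continuous_on ballI DERIV_isCont[OF jetD(1)[OF jet near(2)]]
          DERIV_isCont[OF jetD(3)[OF jet near(2)]]; assumption)+
    then show "continuous_on (cball 0 9) F"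
      unfolding F_def by (intro continuous_intros)
    fix z :: complex assume z: "z \<in> cball 0 9"
    define E where "E z = h z - exp (c * z) / c" for z
    have c0: "c \<noteq> 0" using c by auto
    have "cmod (E z - E 0) \<le> 1944 / 40000 * 9"
    proof (rule fixed_derivative_bound[OF _ h1exp z])
      fix x :: complex assume x: "x \<in> cball 0 9"
      show "(E has_field_derivative h1 x - exp (c * x)) (at x)"
        unfolding E_def using c0 by (auto intro!: derivative_eq_intros jetD(1)[OF jet near(2)[OF x]])
    qed auto
    moreover have "cmod (g z - g 0) \<le> 18 / 40000 * 9"
      by (rule fixed_derivative_bound[OF jetD(3)[OF jet near(2)] g1b z]) auto
    then have "cmod (cnj (g z - g 0)) \<le> 18 / 40000 * 9" by (simp only: complex_mod_cnj)
    moreover have eq: "F z - F 0 - (exp (c * z) - 1) / c = (E z - E 0) + cnj (g z - g 0)"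
      by (simp add: F_def E_def diff_divide_distrib)
    have "cmod (F z - F 0 - (exp (c * z) - 1) / c) \<le> cmod (E z - E 0) + cmod (cnj (g z - g 0))"
      unfolding eq by (rule norm_triangle_ineq)
    ultimately show "cmod (F z - F 0 - (exp (c * z) - 1) / c) < 1 / 2" by linarith
  qed
  moreover have "inj_on F (cball 0 9)"
    unfolding F_def by (rule inj_on_subset[OF inj]) (use near(2) in blast)
  ultimately show False by blast
qed

section \<open>The blow-up argument\<close>

lemma continuous_on_jacobian_slope:
  assumes jet: "sense_preserving_jet S h h1 h2 g g1 g2" and S: "open S"
  shows "continuous_on S (\<lambda>z. jacobian_slope (h1 z) (h2 z) (g1 z) (g2 z))"
proof -
  note c = jet_holomorphic[OF jet S, THEN holomorphic_on_imp_continuous_on]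
  have "h1 z * cnj (h1 z) - g1 z * cnj (g1 z) \<noteq> 0" if "z \<in> S" for z
    by (rule jacobian_nonzero[OF jetD(5)[OF jet that]])
  then show ?thesis unfolding jacobian_slope_def by (intro continuous_intros c) blast
qed

text \<open>
  The normalization of the dilatation at the origin costs nothing: an affine map achieves it and preserves
  univalence as well as $\<partial>/\<partial>z \log J_f$.
\<close>

lemma no_large_univalent_jet:
  assumes jet: "sense_preserving_jet (ball 0 blow_up_radius) h h1 h2 g g1 g2"
    and inj: "inj_on (\<lambda>z. h z + cnj (g z)) (ball 0 blow_up_radius)"
    and one: "cmod (jacobian_slope (h1 0) (h2 0) (g1 0) (g2 0)) = 1"
    and slope: "\<And>z. z \<in> ball 0 blow_up_radius \<Longrightarrow> cmod (jacobian_slope (h1 z) (h2 z) (g1 z) (g2 z)) \<le> 2"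
  shows False
proof -
  have 0: "0 \<in> ball (0::complex) blow_up_radius" using blow_up_radius_ge by simp
  define a where "a = g1 0 / h1 0"
  have h10: "h1 0 \<noteq> 0" and a: "cmod a < 1"
    using jetD(5,6)[OF jet 0] by (auto simp: a_def norm_divide)
  define A where "A = h1 0 - cnj a * g1 0"
  have "cmod (g1 0 - a * h1 0) < cmod A"
    unfolding A_def by (rule affine_norm_mono[OF a jetD(5)[OF jet 0]])
  then have A: "A \<noteq> 0" by auto
  have g10: "g1 0 - a * h1 0 = 0" using h10 by (simp add: a_def)
  have "jacobian_slope ((h1 0 - cnj a * g1 0) / A) ((h2 0 - cnj a * g2 0) / A) ((g1 0 - a * h1 0) / cnj A) ((g2 0 - a * h2 0) / cnj A)
      = (h2 0 - cnj a * g2 0) / A"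
    unfolding g10 A_def[symmetric] using A by (simp add: jacobian_slope_def)
  then have n2: "cmod ((h2 0 - cnj a * g2 0) / A) = 1"
    using one by (simp only: jacobian_slope_affine[OF a A])
  show False
  proof (rule no_large_normalized_univalent_jet[OF jet_affine[OF jet a A] inj_affine[OF inj a A]])
    show "(h1 0 - cnj a * g1 0) / A = 1" using A by (simp add: A_def)
    show "(g1 0 - a * h1 0) / cnj A = 0" by (simp add: g10)
    show "cmod ((h2 0 - cnj a * g2 0) / A) = 1" by (rule n2)
  qed (use slope in \<open>simp only: jacobian_slope_affine[OF a A]\<close>)
qed

text \<open>
  A rescaling argument in the manner of Zalcman and Brody. With $P = \<partial>/\<partial>z \log J_f$, choose $z_0$ to maximize
  $(\<rho> - |z|)\,|P(z)|$ on a closed disk of radius $\<rho> < 1$. In the unit of length $1/|P(z_0)|$ around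
  $z_0$ the rescaled mapping has $|P| = 1$ at the origin and, by maximality, $|P| \<le> 2$ on a disk whose
  radius is half of the maximum. If the maximum were too large, this would contradict the preceding lemma.
\<close>

lemma univalent_jacobian_slope_bound:
  assumes jet: "sense_preserving_jet unit_disk h h1 h2 g g1 g2"
    and inj: "inj_on (\<lambda>z. h z + cnj (g z)) unit_disk" and z1: "z1 \<in> unit_disk"
  shows "cmod (jacobian_slope (h1 z1) (h2 z1) (g1 z1) (g2 z1)) * (1 - cmod z1) \<le> 2 * blow_up_radius"
proof (rule ccontr)
  define P where "P z = jacobian_slope (h1 z) (h2 z) (g1 z) (g2 z)" for z
  define R where "R = blow_up_radius"
  have R: "R \<ge> 40000" using blow_up_radius_ge by (simp add: R_def)
  assume "\<not> ?thesis"
  then have big: "cmod (P z1) * (1 - cmod z1) > 2 * R" by (simp add: P_def R_def)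
  have P1: "cmod (P z1) > 0" using big R by (auto simp: zero_less_mult_iff intro: ccontr)
  \<comment> \<open>Any $\<rho> < 1$ for which $z_1$ still violates the bound, with $1$ replaced by $\<rho>$.\<close>
  define \<rho> where "\<rho> = (1 + (cmod z1 + 2 * R / cmod (P z1))) / 2"
  have "cmod z1 + 2 * R / cmod (P z1) < 1"
    using big P1 by (simp add: field_simps)
  then have \<rho>: "\<rho> < 1" "cmod z1 + 2 * R / cmod (P z1) < \<rho>" by (auto simp: \<rho>_def)
  have "2 * R / cmod (P z1) > 0" using P1 R by simp
  then have z1\<rho>: "cmod z1 < \<rho>" using \<rho> by linarith
  have big1: "(\<rho> - cmod z1) * cmod (P z1) > 2 * R"
    using \<rho>(2) P1 by (simp add: field_simps)
  have sub: "cball 0 \<rho> \<subseteq> unit_disk" using \<rho> by auto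
  have "continuous_on (cball 0 \<rho>) P"
    using continuous_on_jacobian_slope[OF jet open_ball] sub unfolding P_def by (rule continuous_on_subset)
  then have cont: "continuous_on (cball 0 \<rho>) (\<lambda>z. (\<rho> - cmod z) * cmod (P z))"
    by (intro continuous_intros)
  have z1in: "z1 \<in> cball 0 \<rho>" using z1\<rho> by simp
  then have "cball (0::complex) \<rho> \<noteq> {}" by blast
  from continuous_attains_sup[OF compact_cball this cont]
  obtain z0 where z0: "z0 \<in> cball 0 \<rho>"
    "\<And>z. z \<in> cball 0 \<rho> \<Longrightarrow> (\<rho> - cmod z) * cmod (P z) \<le> (\<rho> - cmod z0) * cmod (P z0)"
    by blast
  define N where "N = (\<rho> - cmod z0) * cmod (P z0)"
  have N: "N > 2 * R" using z0(2)[OF z1in] big1 unfolding N_def by linarith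
  have Npos: "N > 0" using N R by simp
  then have P0: "cmod (P z0) > 0" and dist0: "\<rho> - cmod z0 > 0"
    using z0(1) by (auto simp: N_def zero_less_mult_iff)
  \<comment> \<open>The new unit of length; $N/2 > R$ such units around $z_0$ stay well inside the disk of radius $\<rho>$.\<close>
  define l where "l = 1 / cmod (P z0)"
  have l: "l > 0" using P0 by (simp add: l_def)
  have lN: "l * N = \<rho> - cmod z0" using P0 by (simp add: l_def N_def)
  have half: "\<rho> - cmod (z0 + of_real l * x) > (\<rho> - cmod z0) / 2" if x: "x \<in> ball 0 R" for x
  proof -
    have "cmod (of_real l * x) = l * cmod x" using l by (simp add: norm_mult)
    also have "\<dots> < l * (N / 2)" using x N l by simp
    also have "\<dots> = (\<rho> - cmod z0) / 2" using lN by simp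
    finally show ?thesis using norm_triangle_ineq[of z0 "of_real l * x"] by argo
  qed
  have maps: "z0 + of_real l * x \<in> unit_disk" if x: "x \<in> ball 0 R" for x
    using half[OF x] dist0 \<rho>(1) by simp
  note jet' = jet_dilate[OF jet l maps] and inj' = inj_dilate[OF inj l maps]
  show False
  proof (rule no_large_univalent_jet[OF jet'[unfolded R_def] inj'[unfolded R_def]])
    show "cmod (jacobian_slope (h1 (z0 + of_real l * 0)) (of_real l * h2 (z0 + of_real l * 0))
        (g1 (z0 + of_real l * 0)) (of_real l * g2 (z0 + of_real l * 0))) = 1"
      unfolding jacobian_slope_dilate using l P0
      by (simp add: norm_mult P_def[symmetric]) (simp add: l_def)
    fix x :: complex assume "x \<in> ball 0 blow_up_radius"
    then have x: "x \<in> ball 0 R" by (simp add: R_def)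
    let ?z = "z0 + of_real l * x"
    have "?z \<in> cball 0 \<rho>" using half[OF x] dist0 by simp
    from z0(2)[OF this] have "(\<rho> - cmod ?z) * cmod (P ?z) \<le> N" by (simp add: N_def)
    moreover have "(\<rho> - cmod z0) / 2 * cmod (P ?z) \<le> (\<rho> - cmod ?z) * cmod (P ?z)"
      using half[OF x] by (intro mult_right_mono) auto
    ultimately have "(l * N) / 2 * cmod (P ?z) \<le> N" by (simp only: lN)
    then have "N * (l * cmod (P ?z)) \<le> N * 2" by (simp add: algebra_simps)
    then have "l * cmod (P ?z) \<le> 2" using Npos by simp
    then show "cmod (jacobian_slope (h1 ?z) (of_real l * h2 ?z) (g1 ?z) (of_real l * g2 ?z)) \<le> 2"
      unfolding jacobian_slope_dilate using l by (simp add: norm_mult P_def)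
  qed auto
qed

section \<open>From the Jacobian to the Schwarzian derivative\<close>

text \<open>
  Here $p = h''/h'$, $\<omega>$ is the dilatation and $Q = H''/H'$ for $H = h - \bar a g$, the holomorphic part of the affine image
  of $f$ whose dilatation vanishes at $z_0$. The formula for the Schwarzian derivative of $f$ at $z_0$ is
  the classical Schwarzian $Q' - Q^2/2$ of this $H$.
\<close>

lemma shear_schwarzian:
  fixes p \<omega> \<omega>1 :: "complex \<Rightarrow> complex"
  assumes p: "(p has_field_derivative p1) (at z0)" and w: "(\<omega> has_field_derivative \<omega>1 z0) (at z0)"
    and w1: "(\<omega>1 has_field_derivative w2) (at z0)" and lt: "cmod (\<omega> z0) < 1"
    and d: "d = complex_of_real (1 - (cmod (\<omega> z0))\<^sup>2)" and a: "a = \<omega> z0"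
    and Q: "Q = (\<lambda>z. p z - cnj a * \<omega>1 z / (1 - cnj a * \<omega> z))"
  shows "\<exists>Q1. (Q has_field_derivative Q1) (at z0) \<and>
    Q1 - (Q z0)\<^sup>2 / 2 = p1 - (p z0)\<^sup>2 / 2 + cnj a / d * (p z0 * \<omega>1 z0 - w2) - 3 / 2 * (\<omega>1 z0 * cnj a / d)\<^sup>2"
proof -
  have deq: "1 - cnj a * \<omega> z0 = d"
    unfolding d of_real_diff complex_norm_square a by simp
  have "(cmod (\<omega> z0))\<^sup>2 < 1" using lt by (simp add: abs_square_less_1)
  then have dnz: "d \<noteq> 0" unfolding d of_real_eq_0_iff by simp
  define t where "t = cnj a / d"
  have t: "cnj a = t * d" using dnz by (simp add: t_def)
  let ?Q1 = "p1 - (cnj a * w2 * (1 - cnj a * \<omega> z0) - cnj a * \<omega>1 z0 * - (cnj a * \<omega>1 z0)) / ((1 - cnj a * \<omega> z0) * (1 - cnj a * \<omega> z0))"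
  have "((\<lambda>z. 1 - cnj a * \<omega> z) has_field_derivative - (cnj a * \<omega>1 z0)) (at z0)"
    using DERIV_diff[OF DERIV_const DERIV_cmult[OF w]] by simp
  then have der: "(Q has_field_derivative ?Q1) (at z0)"
    unfolding Q using dnz by (intro DERIV_diff p DERIV_divide DERIV_cmult w1) (auto simp: deq)
  have "?Q1 = p1 - t * w2 - (t * \<omega>1 z0)\<^sup>2"
    unfolding deq unfolding t using dnz by (simp add: power2_eq_square field_simps)
  moreover have "Q z0 = p z0 - t * \<omega>1 z0"
    unfolding Q deq unfolding t using dnz by simp
  moreover have "p1 - t * w2 - (t * \<omega>1 z0)\<^sup>2 - (p z0 - t * \<omega>1 z0)\<^sup>2 / 2
      = p1 - (p z0)\<^sup>2 / 2 + t * (p z0 * \<omega>1 z0 - w2) - 3 / 2 * (\<omega>1 z0 * t)\<^sup>2"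
    by (simp add: power2_eq_square field_simps)
  ultimately have "?Q1 - (Q z0)\<^sup>2 / 2 = p1 - (p z0)\<^sup>2 / 2 + t * (p z0 * \<omega>1 z0 - w2) - 3 / 2 * (\<omega>1 z0 * t)\<^sup>2"
    by (simp only:)
  then show ?thesis using der by (intro exI[of _ ?Q1]) (simp add: t_def)
qed

text \<open>
  By \<open>shear_schwarzian\<close> it suffices to bound $Q$ and $Q'$ at $z_0$ for $Q = H''/H'$. On a disk about $z_0$ of radius comparable
  to $r = 1 - |z_0|$, $Q$ differs from $\<partial>/\<partial>z \log J_f$ by at most $2/r$; hence $Q$ is of order $1/r$, and $Q'(z_0)$ is of order
  $1/r^2$ by Cauchy's inequality.
\<close>

lemma schwarzian_bound_from_slope_bound:
  assumes jet: "sense_preserving_jet unit_disk h h1 h2 g g1 g2"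
    and slope: "\<And>z. z \<in> unit_disk \<Longrightarrow> cmod (jacobian_slope (h1 z) (h2 z) (g1 z) (g2 z)) * (1 - cmod z) \<le> M"
    and z0: "z0 \<in> unit_disk"
    and p: "p = (\<lambda>z. h2 z / h1 z)" and w: "\<omega> = (\<lambda>z. g1 z / h1 z)"
    and d: "d = complex_of_real (1 - (cmod (\<omega> z0))\<^sup>2)"
  shows "cmod (deriv p z0 - (p z0)\<^sup>2 / 2 + cnj (\<omega> z0) / d * (p z0 * deriv \<omega> z0 - deriv (deriv \<omega>) z0)
      - 3 / 2 * (deriv \<omega> z0 * cnj (\<omega> z0) / d)\<^sup>2) * (1 - (cmod z0)\<^sup>2)\<^sup>2 \<le> 4 * (4 * (2 * M + 2) + (2 * M + 2)\<^sup>2)"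
proof -
  let ?D = unit_disk
  note hol = jet_holomorphic[OF jet open_ball]
  have holp: "p holomorphic_on ?D" and holw: "\<omega> holomorphic_on ?D"
    unfolding p w using hol jetD(6)[OF jet] by (auto intro!: holomorphic_intros)
  have holw1: "deriv \<omega> holomorphic_on ?D" by (rule holomorphic_deriv[OF holw open_ball])
  define a where "a = \<omega> z0"
  have h10: "h1 z0 \<noteq> 0" and a: "cmod a < 1"
    using jetD(5,6)[OF jet z0] by (auto simp: a_def w norm_divide)
  define r where "r = 1 - cmod z0"
  have r: "r > 0" using z0 by (simp add: r_def)
  have subr: "ball z0 r \<subseteq> ?D"
  proof
    fix x assume "x \<in> ball z0 r"
    then show "x \<in> ?D" using dist_triangle[of 0 x z0] by (simp add: r_def)
  qed
  define H1 where "H1 z = (h1 z - cnj a * g1 z) / 1" for z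
  define H2 where "H2 z = (h2 z - cnj a * g2 z) / 1" for z
  define G1 where "G1 z = (g1 z - a * h1 z) / cnj 1" for z
  define G2 where "G2 z = (g2 z - a * h2 z) / cnj 1" for z
  have jet': "sense_preserving_jet (ball z0 r) (\<lambda>z. (h z - cnj a * g z) / 1) H1 H2 (\<lambda>z. (g z - a * h z) / cnj 1) G1 G2"
    using jet_subset[OF jet_affine[OF jet a, of 1] subr]
    unfolding H1_def[abs_def] H2_def[abs_def] G1_def[abs_def] G2_def[abs_def] by simp
  have G10: "G1 z0 = 0" using h10 by (simp add: G1_def a_def w)
  have M: "M \<ge> 0" 
  proof -
    have "0 \<le> cmod (jacobian_slope (h1 z0) (h2 z0) (g1 z0) (g2 z0)) * (1 - cmod z0)" using z0 by simp
    then show ?thesis using slope[OF z0] by linarith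
  qed
  define Q where "Q = (\<lambda>z. p z - cnj a * deriv \<omega> z / (1 - cnj a * \<omega> z))"
  have Qeq: "Q z = H2 z / H1 z" if z: "z \<in> ?D" for z
  proof -
    have nz: "h1 z \<noteq> 0" by (rule jetD(6)[OF jet z])
    have "(\<omega> has_field_derivative (g2 z * h1 z - g1 z * h2 z) / (h1 z * h1 z)) (at z)"
      unfolding w by (rule DERIV_divide[OF jetD(4)[OF jet z] jetD(2)[OF jet z] nz])
    then have dw: "deriv \<omega> z = (g2 z * h1 z - g1 z * h2 z) / (h1 z * h1 z)" by (rule DERIV_imp_deriv)
    have k: "h1 z - cnj a * g1 z \<noteq> 0" using affine_norm_mono[OF a jetD(5)[OF jet z]] by auto
    have "1 - cnj a * \<omega> z = (h1 z - cnj a * g1 z) / h1 z" using nz by (simp add: w diff_divide_distrib)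
    then have "cnj a * deriv \<omega> z / (1 - cnj a * \<omega> z)
        = cnj a * (g2 z * h1 z - g1 z * h2 z) / (h1 z * (h1 z - cnj a * g1 z))"
      using nz by (simp add: dw)
    then have "Q z = (h2 z * (h1 z - cnj a * g1 z) - cnj a * (g2 z * h1 z - g1 z * h2 z)) / (h1 z * (h1 z - cnj a * g1 z))"
    proof -
      have "u / v - e / (v * k) = (u * k - e) / (v * k)" if "v \<noteq> 0" "k \<noteq> 0" for u v e k :: complex
        using that by (simp add: diff_divide_distrib)
      from this[OF nz k] show ?thesis
        using \<open>cnj a * deriv \<omega> z / (1 - cnj a * \<omega> z) = _\<close> by (simp add: Q_def p)
    qed
    also have "h2 z * (h1 z - cnj a * g1 z) - cnj a * (g2 z * h1 z - g1 z * h2 z) = h1 z * (h2 z - cnj a * g2 z)"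
      by (simp add: algebra_simps)
    also have "h1 z * (h2 z - cnj a * g2 z) / (h1 z * (h1 z - cnj a * g1 z)) = H2 z / H1 z"
      using nz by (simp add: H1_def H2_def)
    finally show ?thesis .
  qed
  have Qb: "cmod (Q z) \<le> (2 * M + 2) / r" if z: "z \<in> ball z0 (r / 2)" for z
  proof -
    have zr: "z \<in> ball z0 r" using z r by auto
    then have zD: "z \<in> ?D" using subr by blast
    let ?P = "jacobian_slope (h1 z) (h2 z) (g1 z) (g2 z)"
    have "jacobian_slope (H1 z) (H2 z) (G1 z) (G2 z) = ?P"
      unfolding H1_def H2_def G1_def G2_def by (rule jacobian_slope_affine[OF a]) simp
    then have 1: "cmod (Q z - ?P) \<le> 2 / r"
      using normalized_jet_estimates(2)[OF jet' r G10 z] Qeq[OF zD] by simp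
    have "cmod z < cmod z0 + r / 2" using z norm_triangle_ineq[of "z - z0" z0]
      by (simp add: dist_norm norm_minus_commute)
    then have "r / 2 \<le> 1 - cmod z" by (simp add: r_def field_simps)
    then have "cmod ?P * (r / 2) \<le> cmod ?P * (1 - cmod z)" by (intro mult_left_mono) auto
    also have "\<dots> \<le> M" by (rule slope[OF zD])
    finally have "cmod ?P \<le> 2 * M / r" using r by (simp add: field_simps)
    with 1 have "cmod (Q z) \<le> 2 * M / r + 2 / r" using norm_triangle_sub[of "Q z" ?P] by linarith
    then show ?thesis by (simp add: add_divide_distrib)
  qed
  have dd: "(p has_field_derivative deriv p z0) (at z0)" "(\<omega> has_field_derivative deriv \<omega> z0) (at z0)"
    "(deriv \<omega> has_field_derivative deriv (deriv \<omega>) z0) (at z0)"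
    by (rule holomorphic_derivI[OF holp open_ball z0] holomorphic_derivI[OF holw open_ball z0]
        holomorphic_derivI[OF holw1 open_ball z0])+
  obtain Q1 where Q1: "(Q has_field_derivative Q1) (at z0)"
    "Q1 - (Q z0)\<^sup>2 / 2 = deriv p z0 - (p z0)\<^sup>2 / 2 + cnj a / d * (p z0 * deriv \<omega> z0 - deriv (deriv \<omega>) z0)
      - 3 / 2 * (deriv \<omega> z0 * cnj a / d)\<^sup>2"
    using shear_schwarzian[OF dd _ d a_def Q_def] a by (auto simp: a_def)
  have "Q holomorphic_on ball z0 (r / 2)"
  proof -
    have "1 - cnj a * \<omega> z \<noteq> 0" if "z \<in> ?D" for z
    proof -
      have "cmod (\<omega> z) < 1" using jetD(5,6)[OF jet that] by (simp add: w norm_divide)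
      then have "cmod a * cmod (\<omega> z) \<le> cmod a * 1" by (intro mult_left_mono) auto
      then have "cmod (cnj a * \<omega> z) < 1" using a by (simp add: norm_mult)
      then show ?thesis by auto
    qed
    then have "Q holomorphic_on ?D" unfolding Q_def using holp holw holw1 by (intro holomorphic_intros) auto
    moreover have "ball z0 (r / 2) \<subseteq> ball z0 r" using r by auto
    ultimately show ?thesis using subr holomorphic_on_subset by blast
  qed
  then have "cmod (deriv Q z0) \<le> ((2 * M + 2) / r) / (r / 4)"
    by (rule deriv_bound_from_ball) (use r Qb in auto)
  then have Q1b: "cmod Q1 \<le> 4 * (2 * M + 2) / r\<^sup>2"
    using DERIV_imp_deriv[OF Q1(1)] by (simp add: power2_eq_square field_simps)
  have "(cmod (Q z0))\<^sup>2 \<le> ((2 * M + 2) / r)\<^sup>2" using Qb[of z0] r by (intro power_mono) auto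
  then have "(cmod (Q z0))\<^sup>2 \<le> (2 * M + 2)\<^sup>2 / r\<^sup>2" by (simp only: power_divide)
  moreover have "cmod ((Q z0)\<^sup>2 / 2) = (cmod (Q z0))\<^sup>2 / 2" by (simp add: norm_divide norm_power)
  ultimately have "cmod ((Q z0)\<^sup>2 / 2) \<le> (2 * M + 2)\<^sup>2 / r\<^sup>2"
    using zero_le_power2[of "cmod (Q z0)"] by linarith
  with Q1b have "cmod (Q1 - (Q z0)\<^sup>2 / 2) \<le> 4 * (2 * M + 2) / r\<^sup>2 + (2 * M + 2)\<^sup>2 / r\<^sup>2"
    using norm_triangle_ineq4[of Q1 "(Q z0)\<^sup>2 / 2"] by linarith
  then have S: "cmod (Q1 - (Q z0)\<^sup>2 / 2) \<le> (4 * (2 * M + 2) + (2 * M + 2)\<^sup>2) / r\<^sup>2" (is "_ \<le> ?K / _")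
    by (simp only: add_divide_distrib)
  have "1 - (cmod z0)\<^sup>2 = r * (1 + cmod z0)" by (simp add: r_def power2_eq_square algebra_simps)
  also have "\<dots> \<le> r * 2" using r z0 by (intro mult_left_mono) auto
  finally have "1 - (cmod z0)\<^sup>2 \<le> r * 2" .
  moreover have "0 \<le> 1 - (cmod z0)\<^sup>2" using z0 by (simp add: abs_square_le_1)
  ultimately have "(1 - (cmod z0)\<^sup>2)\<^sup>2 \<le> (r * 2)\<^sup>2" by (intro power_mono)
  then have "cmod (Q1 - (Q z0)\<^sup>2 / 2) * (1 - (cmod z0)\<^sup>2)\<^sup>2 \<le> ?K / r\<^sup>2 * (r * 2)\<^sup>2"
    using S M by (intro mult_mono) auto
  also have "\<dots> = 4 * ?K" using r by (simp add: power_mult_distrib)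
  finally show ?thesis unfolding Q1(2) a_def .
qed

section \<open>The Schwarzian norm of a univalent harmonic mapping\<close>

lemma harmonic_decomposition_cnj:
  "harmonic_decomposition f h g \<Longrightarrow> harmonic_decomposition (\<lambda>z. cnj (f z)) g h"
  by (auto simp: harmonic_decomposition_def)

lemma decomposition_imp_parts:
  assumes "harmonic_decomposition f h g"
  shows "harmonic_decomposition f (analytic_part f) (coanalytic_part f)"
proof -
  have "\<exists>h. \<exists>g. harmonic_decomposition f h g" using assms by blast
  then have "\<exists>g. harmonic_decomposition f (analytic_part f) g"
    unfolding analytic_part_def by (rule someI_ex)
  then show ?thesis unfolding coanalytic_part_def by (rule someI_ex)
qed

text \<open>
  The derivatives $h'$ and $g'$ are the complex linear and the conjugate of the antilinear part of the real
  differential of $f$.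
\<close>

lemma harmonic_decomposition_deriv_unique:
  assumes d: "harmonic_decomposition f h g" "harmonic_decomposition f H G" and z: "z \<in> unit_disk"
  shows "deriv h z = deriv H z" "deriv g z = deriv G z"
proof -
  have der: "(f has_derivative (\<lambda>v. deriv h z * v + cnj (deriv g z * v))) (at z)"
    if "harmonic_decomposition f h g" for h g
  proof -
    have hg: "h holomorphic_on unit_disk" "g holomorphic_on unit_disk"
      and eq: "\<And>x. x \<in> unit_disk \<Longrightarrow> f x = h x + cnj (g x)"
      using that by (auto simp: harmonic_decomposition_def)
    have "(h has_derivative (\<lambda>v. deriv h z * v)) (at z)" "(g has_derivative (\<lambda>v. deriv g z * v)) (at z)"
      using holomorphic_derivI[OF hg(1) open_ball z] holomorphic_derivI[OF hg(2) open_ball z]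
      by (simp_all add: has_field_derivative_def)
    then have "((\<lambda>x. h x + cnj (g x)) has_derivative (\<lambda>v. deriv h z * v + cnj (deriv g z * v))) (at z)"
      by (intro has_derivative_add has_derivative_cnj)
    then show ?thesis
      by (rule has_derivative_transform_within_open[OF _ open_ball z]) (simp add: eq)
  qed
  have "(\<lambda>v. deriv h z * v + cnj (deriv g z * v)) = (\<lambda>v. deriv H z * v + cnj (deriv G z * v))"
    by (rule has_derivative_unique[OF der[OF d(1)] der[OF d(2)]])
  from fun_cong[OF this, of 1] fun_cong[OF this, of \<i>]
  show "deriv h z = deriv H z" "deriv g z = deriv G z"
    by (simp_all add: complex_eq_iff)
qed

text \<open>
  The bound of \<open>schwarzian_bound_from_slope_bound\<close> for $M = 2 R$ with $R$ the blow-up radius.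
\<close>

definition schwarzian_bound :: real where
  "schwarzian_bound = 4 * (4 * (4 * blow_up_radius + 2) + (4 * blow_up_radius + 2)\<^sup>2)"

lemma sense_preserving_schwarzian_bound:
  assumes dec: "harmonic_decomposition f h0 g0" and inj: "inj_on f unit_disk" and pos: "sense_preserving f"
    and z: "z \<in> unit_disk"
  shows "cmod (sense_preserving_schwarzian f z) * (1 - (cmod z)\<^sup>2)\<^sup>2 \<le> schwarzian_bound"
proof -
  define h where "h = analytic_part f"
  define g where "g = coanalytic_part f"
  have "harmonic_decomposition f h g" unfolding h_def g_def by (rule decomposition_imp_parts[OF dec])
  then have hg: "h holomorphic_on unit_disk" "g holomorphic_on unit_disk"
    and eq: "\<And>x. x \<in> unit_disk \<Longrightarrow> f x = h x + cnj (g x)"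
    by (auto simp: harmonic_decomposition_def)
  note hg1 = holomorphic_deriv[OF hg(1) open_ball] holomorphic_deriv[OF hg(2) open_ball]
  have jet: "sense_preserving_jet unit_disk h (deriv h) (deriv (deriv h)) g (deriv g) (deriv (deriv g))"
    unfolding sense_preserving_jet_def
  proof (intro ballI conjI)
    fix x assume x: "x \<in> unit_disk"
    have "(cmod (deriv g x))\<^sup>2 < (cmod (deriv h x))\<^sup>2"
      using pos x by (auto simp: sense_preserving_def harmonic_jacobian_def h_def g_def)
    then show "cmod (deriv g x) < cmod (deriv h x)" by (rule power_less_imp_less_base) simp
  qed (intro holomorphic_derivI[OF hg(1) open_ball] holomorphic_derivI[OF hg(2) open_ball]
        holomorphic_derivI[OF hg1(1) open_ball] holomorphic_derivI[OF hg1(2) open_ball]; assumption)+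
  have inj': "inj_on (\<lambda>z. h z + cnj (g z)) unit_disk"
    using inj eq by (auto simp: inj_on_def)
  define \<omega> where "\<omega> = dilatation f"
  have w: "\<omega> = (\<lambda>z. deriv g z / deriv h z)" by (rule ext) (simp add: \<omega>_def dilatation_def h_def g_def)
  have p: "pre_schwarzian h = (\<lambda>z. deriv (deriv h) z / deriv h z)" by (rule ext) (simp add: pre_schwarzian_def)
  have S: "sense_preserving_schwarzian f z = deriv (pre_schwarzian h) z - (pre_schwarzian h z)\<^sup>2 / 2
      + cnj (\<omega> z) / complex_of_real (1 - (cmod (\<omega> z))\<^sup>2) * (pre_schwarzian h z * deriv \<omega> z - deriv (deriv \<omega>) z)
      - 3 / 2 * (deriv \<omega> z * cnj (\<omega> z) / complex_of_real (1 - (cmod (\<omega> z))\<^sup>2))\<^sup>2"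
    unfolding sense_preserving_schwarzian_def Let_def classical_schwarzian_def h_def[symmetric] \<omega>_def[symmetric]
    by (simp only: pre_schwarzian_def[of h z])
  show ?thesis
    unfolding S
    using schwarzian_bound_from_slope_bound[OF jet univalent_jacobian_slope_bound[OF jet inj'] z p w refl]
    by (simp add: schwarzian_bound_def)
qed

text \<open>
  By Lewy's theorem the Jacobian has no zero, and it is continuous on a connected set.
\<close>

lemma univalent_sense_preserving_or_reversing:
  assumes dec: "harmonic_decomposition f h0 g0" and inj: "inj_on f unit_disk"
  shows "sense_preserving f \<or> sense_reversing f"
proof -
  define h where "h = analytic_part f"
  define g where "g = coanalytic_part f"
  have "harmonic_decomposition f h g" unfolding h_def g_def by (rule decomposition_imp_parts[OF dec])
  then have hg: "h holomorphic_on unit_disk" "g holomorphic_on unit_disk"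
    and eq: "\<And>x. x \<in> unit_disk \<Longrightarrow> f x = h x + cnj (g x)"
    by (auto simp: harmonic_decomposition_def)
  have inj': "inj_on (\<lambda>z. h z + cnj (g z)) unit_disk"
    using inj eq by (auto simp: inj_on_def)
  define J where "J z = (cmod (deriv h z))\<^sup>2 - (cmod (deriv g z))\<^sup>2" for z
  have J: "harmonic_jacobian f = J" by (rule ext) (simp add: harmonic_jacobian_def J_def h_def g_def)
  have nz: "J z \<noteq> 0" if "z \<in> unit_disk" for z
    using lewy_univalent_harmonic[OF hg open_ball _ that inj'] by (simp add: J_def)
  have "continuous_on unit_disk J"
    unfolding J_def using hg
    by (intro continuous_intros holomorphic_on_imp_continuous_on holomorphic_deriv open_ball)
  then have conn: "connected (J ` unit_disk)" by (rule connected_continuous_image) simp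
  have False if "x \<in> unit_disk" "y \<in> unit_disk" "J x < 0" "J y > 0" for x y
  proof -
    have "0 \<in> J ` unit_disk" using connectedD_interval[OF conn, of "J x" "J y" 0] that by auto
    then show False using nz by auto
  qed
  then show ?thesis
    unfolding sense_preserving_def sense_reversing_def J using nz by (meson linorder_neqE_linordered_idom)
qed

theorem theorem5:
  shows "\<exists>C::real. C > 0 \<and>
    (\<forall>f :: complex \<Rightarrow> complex. harmonic_on unit_disk f \<and> inj_on f unit_disk \<longrightarrow>
        schwarzian_norm f \<le> ereal C)"
proof (intro exI[of _ schwarzian_bound] conjI allI impI)
  have "blow_up_radius > 0" using blow_up_radius_ge by linarith
  then show "schwarzian_bound > 0" unfolding schwarzian_bound_def by (intro mult_pos_pos add_pos_nonneg) auto
  fix f :: "complex \<Rightarrow> complex"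
  assume f: "harmonic_on unit_disk f \<and> inj_on f unit_disk"
  then have inj: "inj_on f unit_disk" by blast
  obtain h g where dec: "harmonic_decomposition f h g" using harmonic_on_decomposition f by blast
  have "cmod (harmonic_schwarzian f z) * (1 - (cmod z)\<^sup>2)\<^sup>2 \<le> schwarzian_bound" if z: "z \<in> unit_disk" for z
  proof (cases "sense_preserving f")
    case True
    then show ?thesis
      using sense_preserving_schwarzian_bound[OF dec inj True z] by (simp add: harmonic_schwarzian_def)
  next
    case False
    then have rev: "sense_reversing f" using univalent_sense_preserving_or_reversing[OF dec inj] by blast
    define F where "F = (\<lambda>z. cnj (f z))"
    have decF: "harmonic_decomposition F (coanalytic_part f) (analytic_part f)"
      unfolding F_def by (rule harmonic_decomposition_cnj[OF decomposition_imp_parts[OF dec]])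
    have injF: "inj_on F unit_disk" using inj by (auto simp: F_def inj_on_def)
    have "harmonic_jacobian F x = - harmonic_jacobian f x" if "x \<in> unit_disk" for x
      using harmonic_decomposition_deriv_unique[OF decomposition_imp_parts[OF decF] decF that]
      by (simp add: harmonic_jacobian_def)
    then have "sense_preserving F" using rev by (simp add: sense_preserving_def sense_reversing_def)
    then show ?thesis
      using sense_preserving_schwarzian_bound[OF decF injF _ z] False rev
      by (simp add: harmonic_schwarzian_def F_def)
  qed
  then show "schwarzian_norm f \<le> ereal schwarzian_bound"
    unfolding schwarzian_norm_def by (intro SUP_least) simp
qed

end
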